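(* For every field $F$ there exists an affine PI-algebra over $F$ which satisfies the ascending chain condition on two-sided ideals and which is not weakly representable.
   Context: Algebras are associative with unit. An $F$-algebra is affine if it is finitely generated as an $F$-algebra. A PI-algebra is an algebra satisfying a nontrivial polynomial identity. An algebra is weakly representable if it embeds (as a ring) into a matrix ring $M_n(C)$ for some $n\geq 1$ and some commutative ring $C$. *)

theory Defs
  imports "HOL-Algebra.Algebra" "HOL-Algebra.Weak_Morphisms"
begin

section \<open>Associative unital algebras\<close>

text \<open>The locale \<^locale>\<open>algebra\<close> of HOL-Algebra requires a commutative multiplication, hence the
  following variant.\<close>

locale assoc_algebra = module R M + ring M for R and M (structure) +
  assumes smult_mult_left:
      "\<lbrakk> a \<in> carrier R; x \<in> carrier M; y \<in> carrier M \<rbrakk> \<Longrightarrow>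
        (a \<odot>\<^bsub>M\<^esub> x) \<otimes>\<^bsub>M\<^esub> y = a \<odot>\<^bsub>M\<^esub> (x \<otimes>\<^bsub>M\<^esub> y)"
    and smult_mult_right:
      "\<lbrakk> a \<in> carrier R; x \<in> carrier M; y \<in> carrier M \<rbrakk> \<Longrightarrow>
        x \<otimes>\<^bsub>M\<^esub> (a \<odot>\<^bsub>M\<^esub> y) = a \<odot>\<^bsub>M\<^esub> (x \<otimes>\<^bsub>M\<^esub> y)"

definition unital_subalgebra ::
  "('a, 'm) ring_scheme \<Rightarrow> ('a, 'b, 'n) module_scheme \<Rightarrow> 'b set \<Rightarrow> bool"
where
  "unital_subalgebra F A B \<longleftrightarrow>
     subring B A \<and> (\<forall>a\<in>carrier F. \<forall>x\<in>B. a \<odot>\<^bsub>A\<^esub> x \<in> B)"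

definition affine_algebra :: "('a, 'm) ring_scheme \<Rightarrow> ('a, 'b, 'n) module_scheme \<Rightarrow> bool"
where
  "affine_algebra F A \<longleftrightarrow>
     (\<exists>S. finite S \<and> S \<subseteq> carrier A \<and>
        (\<forall>B. unital_subalgebra F A B \<and> S \<subseteq> B \<longrightarrow> B = carrier A))"


section \<open>Polynomial identities\<close>

text \<open>An element of the free algebra over \<open>F\<close> on noncommuting variables \<open>x\<^sub>0, x\<^sub>1, \<dots>\<close> is given by
  its finitely supported family of coefficients, indexed by the words in the variables.\<close>

definition nc_polys :: "('a, 'm) ring_scheme \<Rightarrow> (nat list \<Rightarrow> 'a) set"
where
  "nc_polys F = {f. (\<forall>w. f w \<in> carrier F) \<and> finite {w. f w \<noteq> \<zero>\<^bsub>F\<^esub>}}"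

definition nc_word_eval :: "('b, 'n) monoid_scheme \<Rightarrow> (nat \<Rightarrow> 'b) \<Rightarrow> nat list \<Rightarrow> 'b"
where
  "nc_word_eval A x w = foldr (\<lambda>i y. x i \<otimes>\<^bsub>A\<^esub> y) w \<one>\<^bsub>A\<^esub>"

definition nc_poly_eval ::
  "('a, 'm) ring_scheme \<Rightarrow> ('a, 'b, 'n) module_scheme \<Rightarrow> (nat list \<Rightarrow> 'a) \<Rightarrow> (nat \<Rightarrow> 'b) \<Rightarrow> 'b"
where
  "nc_poly_eval F A f x =
     (\<Oplus>\<^bsub>A\<^esub> w \<in> {w. f w \<noteq> \<zero>\<^bsub>F\<^esub>}. f w \<odot>\<^bsub>A\<^esub> nc_word_eval A x w)"

definition PI_algebra :: "('a, 'm) ring_scheme \<Rightarrow> ('a, 'b, 'n) module_scheme \<Rightarrow> bool"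
where
  "PI_algebra F A \<longleftrightarrow>
     (\<exists>f\<in>nc_polys F. f \<noteq> (\<lambda>w. \<zero>\<^bsub>F\<^esub>) \<and>
        (\<forall>x. (\<forall>i. x i \<in> carrier A) \<longrightarrow> nc_poly_eval F A f x = \<zero>\<^bsub>A\<^esub>))"


section \<open>Ascending chain condition\<close>

text \<open>The predicate \<^const>\<open>ideal\<close> means two-sided ideal. Since the algebras are unital, ring ideals
  are the same as algebra ideals.\<close>

definition acc_ideals :: "('b, 'n) ring_scheme \<Rightarrow> bool"
where
  "acc_ideals A \<longleftrightarrow>
     (\<forall>I :: nat \<Rightarrow> 'b set. (\<forall>k. ideal (I k) A \<and> I k \<subseteq> I (Suc k)) \<longrightarrow>
        (\<exists>N. \<forall>k\<ge>N. I k = I N))"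


section \<open>Matrix rings and weak representability\<close>

definition matrix_ring :: "nat \<Rightarrow> ('c, 'k) ring_scheme \<Rightarrow> (nat \<times> nat \<Rightarrow> 'c) ring"
where
  "matrix_ring n C =
     \<lparr> carrier = {..<n} \<times> {..<n} \<rightarrow>\<^sub>E carrier C,
       monoid.mult = (\<lambda>P Q. \<lambda>(i, j)\<in>{..<n} \<times> {..<n}.
                        \<Oplus>\<^bsub>C\<^esub> k\<in>{..<n}. P (i, k) \<otimes>\<^bsub>C\<^esub> Q (k, j)),
       one = (\<lambda>(i, j)\<in>{..<n} \<times> {..<n}. if i = j then \<one>\<^bsub>C\<^esub> else \<zero>\<^bsub>C\<^esub>),
       ring.zero = (\<lambda>p\<in>{..<n} \<times> {..<n}. \<zero>\<^bsub>C\<^esub>),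
       ring.add = (\<lambda>P Q. \<lambda>p\<in>{..<n} \<times> {..<n}. P p \<oplus>\<^bsub>C\<^esub> Q p) \<rparr>"

definition embeds_in_matrix_ring ::
  "('b, 'n) ring_scheme \<Rightarrow> nat \<Rightarrow> ('c, 'k) ring_scheme \<Rightarrow> bool"
where
  "embeds_in_matrix_ring A n C \<longleftrightarrow>
     (\<exists>\<phi>\<in>ring_hom A (matrix_ring n C). inj_on \<phi> (carrier A))"

text \<open>A definition cannot quantify over the type of the elements of \<open>C\<close>. Fixing that type to be
  \<open>(nat \<times> 'b) list\<close>, for a ring on the type \<open>'b\<close>, loses no generality: this is the lemma
  \<open>weakly_representableI\<close> below, in which the type of the elements of \<open>C\<close> is arbitrary. The reason is
  that \<open>C\<close> can be replaced by the subring generated by the matrix entries of the image of \<open>A\<close>.\<close>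

definition weakly_representable :: "('b, 'n) ring_scheme \<Rightarrow> bool"
where
  "weakly_representable A \<longleftrightarrow>
     (\<exists>n\<ge>1. \<exists>C :: ((nat \<times> 'b) list) ring. cring C \<and> embeds_in_matrix_ring A n C)"

text \<open>Subrings generated by a family indexed by \<open>nat \<times> 'b\<close>: every element is the value of a
  term, written in reverse Polish notation as a list of tokens.\<close>

fun rpn_step :: "('c, 'k) ring_scheme \<Rightarrow> (nat \<times> 'b \<Rightarrow> 'c) \<Rightarrow> nat \<times> 'b \<Rightarrow> 'c list \<Rightarrow> 'c list"
where
  "rpn_step C g (0, b) st = \<one>\<^bsub>C\<^esub> # st"
| "rpn_step C g (Suc 0, b) st = (\<ominus>\<^bsub>C\<^esub> hd st) # tl st"
| "rpn_step C g (Suc (Suc 0), b) st = (hd (tl st) \<oplus>\<^bsub>C\<^esub> hd st) # tl (tl st)"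
| "rpn_step C g (Suc (Suc (Suc 0)), b) st = (hd (tl st) \<otimes>\<^bsub>C\<^esub> hd st) # tl (tl st)"
| "rpn_step C g (Suc (Suc (Suc (Suc m))), b) st = g (m, b) # st"

lemma generate_ring_rpn:
  assumes "y \<in> generate_ring C (range g)"
  shows "\<exists>ts. \<forall>st. fold (rpn_step C g) ts st = y # st"
  using assms
proof (induction rule: generate_ring.induct)
  case one
  have "\<forall>st. fold (rpn_step C g) [(0, undefined)] st = \<one>\<^bsub>C\<^esub> # st" by simp
  then show ?case by blast
next
  case (incl h)
  then obtain m b where "h = g (m, b)" by auto
  then have "\<forall>st. fold (rpn_step C g) [(Suc (Suc (Suc (Suc m))), b)] st = h # st" by simp
  then show ?case by blast
next
  case (a_inv h)
  then obtain ts where "\<forall>st. fold (rpn_step C g) ts st = h # st" by blast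
  then have "\<forall>st. fold (rpn_step C g) (ts @ [(Suc 0, undefined)]) st = (\<ominus>\<^bsub>C\<^esub> h) # st" by simp
  then show ?case by blast
next
  case (eng_add h1 h2)
  then obtain ts us where "\<forall>st. fold (rpn_step C g) ts st = h1 # st"
    "\<forall>st. fold (rpn_step C g) us st = h2 # st" by blast
  then have "\<forall>st. fold (rpn_step C g) (ts @ us @ [(Suc (Suc 0), undefined)]) st
      = (h1 \<oplus>\<^bsub>C\<^esub> h2) # st" by simp
  then show ?case by blast
next
  case (eng_mult h1 h2)
  then obtain ts us where "\<forall>st. fold (rpn_step C g) ts st = h1 # st"
    "\<forall>st. fold (rpn_step C g) us st = h2 # st" by blast
  then have "\<forall>st. fold (rpn_step C g) (ts @ us @ [(Suc (Suc (Suc 0)), undefined)]) st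
      = (h1 \<otimes>\<^bsub>C\<^esub> h2) # st" by simp
  then show ?case by blast
qed

lemma generate_ring_inj:
  fixes g :: "nat \<times> 'b \<Rightarrow> 'c"
  shows "\<exists>e :: 'c \<Rightarrow> (nat \<times> 'b) list. inj_on e (generate_ring C (range g))"
proof -
  obtain e :: "'c \<Rightarrow> (nat \<times> 'b) list"
    where e: "\<And>y. y \<in> generate_ring C (range g) \<Longrightarrow> fold (rpn_step C g) (e y) [] = [y]"
    using generate_ring_rpn[of _ C g] by metis
  show ?thesis
    by (rule exI[of _ e]) (metis (no_types, lifting) e inj_onI list.inject)
qed

lemma embeds_in_matrix_ring_hom:
  assumes h: "ring_hom_cring R S h" and inj: "inj_on h (carrier R)"
    and emb: "embeds_in_matrix_ring A n R"
  shows "embeds_in_matrix_ring A n S"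
proof -
  interpret h: ring_hom_cring R S h by (rule h)
  let ?B = "{..<n} \<times> {..<n}"
  obtain \<phi> where hom: "\<phi> \<in> ring_hom A (matrix_ring n R)" and \<phi>: "inj_on \<phi> (carrier A)"
    using emb unfolding embeds_in_matrix_ring_def by blast
  have car: "\<phi> a \<in> ?B \<rightarrow>\<^sub>E carrier R" if "a \<in> carrier A" for a
    using ring_hom_memE(1)[OF hom that] by (simp add: matrix_ring_def)
  have el: "\<phi> a (i, j) \<in> carrier R" if "a \<in> carrier A" "i < n" "j < n" for a i j
    using car[OF that(1)] that(2,3) by auto
  define \<psi> where "\<psi> a = (\<lambda>p\<in>?B. h (\<phi> a p))" for a
  have "\<psi> \<in> ring_hom A (matrix_ring n S)"
  proof (rule ring_hom_memI)
    fix a assume "a \<in> carrier A"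
    then show "\<psi> a \<in> carrier (matrix_ring n S)"
      by (auto simp: \<psi>_def matrix_ring_def el)
  next
    fix a b assume ab: "a \<in> carrier A" "b \<in> carrier A"
    show "\<psi> (a \<otimes>\<^bsub>A\<^esub> b) = \<psi> a \<otimes>\<^bsub>matrix_ring n S\<^esub> \<psi> b"
    proof (rule ext)
      fix p
      show "\<psi> (a \<otimes>\<^bsub>A\<^esub> b) p = (\<psi> a \<otimes>\<^bsub>matrix_ring n S\<^esub> \<psi> b) p"
      proof (cases "p \<in> ?B")
        case True
        then obtain i j where p: "p = (i, j)" "i < n" "j < n" by auto
        have "h (\<phi> (a \<otimes>\<^bsub>A\<^esub> b) p)
            = h (\<Oplus>\<^bsub>R\<^esub> k\<in>{..<n}. \<phi> a (i, k) \<otimes>\<^bsub>R\<^esub> \<phi> b (k, j))"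
          using p by (simp add: ring_hom_memE(2)[OF hom ab] matrix_ring_def)
        also have "\<dots> = (\<Oplus>\<^bsub>S\<^esub> k\<in>{..<n}. (h \<circ> (\<lambda>k. \<phi> a (i, k) \<otimes>\<^bsub>R\<^esub> \<phi> b (k, j))) k)"
          using p ab by (intro h.hom_finsum) (auto simp: el)
        also have "\<dots> = (\<Oplus>\<^bsub>S\<^esub> k\<in>{..<n}. h (\<phi> a (i, k)) \<otimes>\<^bsub>S\<^esub> h (\<phi> b (k, j)))"
          using p ab by (intro h.S.finsum_cong') (auto simp: el)
        also have "\<dots> = (\<Oplus>\<^bsub>S\<^esub> k\<in>{..<n}. \<psi> a (i, k) \<otimes>\<^bsub>S\<^esub> \<psi> b (k, j))"
          using p ab by (intro h.S.finsum_cong') (auto simp: el \<psi>_def)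
        finally show ?thesis
          using p by (simp add: \<psi>_def matrix_ring_def)
      qed (auto simp: \<psi>_def matrix_ring_def)
    qed
    show "\<psi> (a \<oplus>\<^bsub>A\<^esub> b) = \<psi> a \<oplus>\<^bsub>matrix_ring n S\<^esub> \<psi> b"
      using ab by (auto simp: \<psi>_def matrix_ring_def ring_hom_memE(3)[OF hom ab] el fun_eq_iff)
  next
    show "\<psi> \<one>\<^bsub>A\<^esub> = \<one>\<^bsub>matrix_ring n S\<^esub>"
      by (auto simp: \<psi>_def ring_hom_memE(4)[OF hom] matrix_ring_def fun_eq_iff)
  qed
  moreover have "inj_on \<psi> (carrier A)"
  proof (rule inj_onI)
    fix a b assume ab: "a \<in> carrier A" "b \<in> carrier A" and eq: "\<psi> a = \<psi> b"
    have "\<phi> a = \<phi> b"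
    proof (rule PiE_ext[OF car[OF ab(1)] car[OF ab(2)]])
      fix p assume p: "p \<in> ?B"
      then have "h (\<phi> a p) = h (\<phi> b p)" using fun_cong[OF eq, of p] by (simp add: \<psi>_def)
      then show "\<phi> a p = \<phi> b p"
        using inj_onD[OF inj] p el[OF ab(1)] el[OF ab(2)] by auto
    qed
    then show "a = b" using \<phi> ab by (auto dest: inj_onD)
  qed
  ultimately show ?thesis unfolding embeds_in_matrix_ring_def by blast
qed

lemma embeds_in_matrix_ring_subring:
  assumes "cring C" and "subring B C" and hom: "\<phi> \<in> ring_hom A (matrix_ring n C)"
    and inj: "inj_on \<phi> (carrier A)"
    and B: "\<And>a p. a \<in> carrier A \<Longrightarrow> p \<in> {..<n} \<times> {..<n} \<Longrightarrow> \<phi> a p \<in> B"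
  shows "embeds_in_matrix_ring A n (C\<lparr>carrier := B\<rparr>)"
proof -
  interpret C: cring C by fact
  let ?C = "C\<lparr>carrier := B\<rparr>"
  have sub: "B \<subseteq> carrier C" using subringE(1)[OF assms(2)] .
  have "cring ?C" using C.subcring_iff[OF sub] C.subcringI'[OF assms(2)] by simp
  then interpret id: ring_hom_cring ?C C "\<lambda>x. x"
    using sub
    by (intro ring_hom_cring.intro C.cring_axioms) (auto simp: ring_hom_cring_axioms_def ring_hom_def)
  have el: "\<phi> a (i, j) \<in> B" if "a \<in> carrier A" "i < n" "j < n" for a i j
    using B that by auto
  have "\<phi> \<in> ring_hom A (matrix_ring n ?C)"
  proof (rule ring_hom_memI)
    fix a assume a: "a \<in> carrier A"
    show "\<phi> a \<in> carrier (matrix_ring n ?C)"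
      using ring_hom_memE(1)[OF hom a] B[OF a] by (auto simp: matrix_ring_def PiE_def)
  next
    fix a b assume ab: "a \<in> carrier A" "b \<in> carrier A"
    have "(\<Oplus>\<^bsub>?C\<^esub> k\<in>{..<n}. \<phi> a (i, k) \<otimes>\<^bsub>C\<^esub> \<phi> b (k, j))
        = (\<Oplus>\<^bsub>C\<^esub> k\<in>{..<n}. \<phi> a (i, k) \<otimes>\<^bsub>C\<^esub> \<phi> b (k, j))" if "i < n" "j < n" for i j
      using id.hom_finsum[of "\<lambda>k. \<phi> a (i, k) \<otimes>\<^bsub>C\<^esub> \<phi> b (k, j)" "{..<n}"] that ab
        subringE(6)[OF assms(2)] el
      by (simp add: Pi_def comp_def)
    then show "\<phi> (a \<otimes>\<^bsub>A\<^esub> b) = \<phi> a \<otimes>\<^bsub>matrix_ring n ?C\<^esub> \<phi> b"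
      by (auto simp: ring_hom_memE(2)[OF hom ab] matrix_ring_def fun_eq_iff)
    show "\<phi> (a \<oplus>\<^bsub>A\<^esub> b) = \<phi> a \<oplus>\<^bsub>matrix_ring n ?C\<^esub> \<phi> b"
      by (simp add: ring_hom_memE(3)[OF hom ab] matrix_ring_def)
  next
    show "\<phi> \<one>\<^bsub>A\<^esub> = \<one>\<^bsub>matrix_ring n ?C\<^esub>"
      by (auto simp: ring_hom_memE(4)[OF hom] matrix_ring_def fun_eq_iff)
  qed
  then show ?thesis using inj unfolding embeds_in_matrix_ring_def by blast
qed

lemma weakly_representableI:
  fixes A :: "('b, 'n) ring_scheme" and C :: "('c, 'k) ring_scheme"
  assumes "n \<ge> 1" and "cring C" and "embeds_in_matrix_ring A n C"
  shows "weakly_representable A"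
proof -
  interpret C: cring C by fact
  let ?B = "{..<n} \<times> {..<n}"
  obtain \<phi> where hom: "\<phi> \<in> ring_hom A (matrix_ring n C)" and inj: "inj_on \<phi> (carrier A)"
    using assms(3) unfolding embeds_in_matrix_ring_def by blast
  define g where "g = (\<lambda>(m, a). if a \<in> carrier A \<and> prod_decode m \<in> ?B
                                 then \<phi> a (prod_decode m) else \<zero>\<^bsub>C\<^esub>)"
  define B where "B = generate_ring C (range g)"
  have car: "\<phi> a p \<in> carrier C" if "a \<in> carrier A" "p \<in> ?B" for a p
    using ring_hom_memE(1)[OF hom that(1)] that(2) by (auto simp: matrix_ring_def)
  have g: "range g \<subseteq> carrier C" by (auto simp: g_def intro!: car)
  have sub: "subring B C" unfolding B_def by (rule C.generate_ring_is_subring[OF g])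
  have "\<phi> a p \<in> B" if "a \<in> carrier A" "p \<in> ?B" for a p
  proof -
    have "\<phi> a p = g (prod_encode p, a)" using that by (simp add: g_def)
    then show ?thesis unfolding B_def by (metis generate_ring.incl rangeI)
  qed
  then have emb: "embeds_in_matrix_ring A n (C\<lparr>carrier := B\<rparr>)"
    by (rule embeds_in_matrix_ring_subring[OF assms(2) sub hom inj])
  obtain e :: "'c \<Rightarrow> (nat \<times> 'b) list" where e: "inj_on e B"
    unfolding B_def using generate_ring_inj by blast
  let ?C = "C\<lparr>carrier := B\<rparr>" and ?D = "image_ring e (C\<lparr>carrier := B\<rparr>)"
  have cr: "cring ?C"
    using C.subcring_iff[OF subringE(1)[OF sub]] C.subcringI'[OF sub] by simp
  have iso: "e \<in> ring_iso ?C ?D" by (rule inj_imp_image_ring_iso) (simp add: e)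
  have "cring (?D\<lparr>zero := e \<zero>\<^bsub>?C\<^esub>\<rparr>)" by (rule cring.ring_iso_imp_img_cring[OF cr iso])
  moreover have "?D\<lparr>zero := e \<zero>\<^bsub>?C\<^esub>\<rparr> = ?D" using image_ring_zero[of e ?C] by simp
  ultimately have crD: "cring ?D" by simp
  have "ring_hom_cring ?C ?D e"
    using cr crD iso by (auto simp: ring_hom_cring_def ring_hom_cring_axioms_def ring_iso_def)
  then have "embeds_in_matrix_ring A n ?D"
    by (rule embeds_in_matrix_ring_hom[OF _ _ emb]) (simp add: e)
  then show ?thesis using crD assms(1) unfolding weakly_representable_def by blast
qed

end

theory Submission
  imports Defs
begin

text \<open>
  Consider the matrices with rows \<open>(p(0), q, s)\<close>, \<open>(0, p, r)\<close>, \<open>(0, 0, p(0))\<close>, where \<open>p, q, r\<close> are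
  polynomials in \<open>x\<close> over \<open>F\<close> and \<open>s\<close> is a scalar. They are multiplied as matrices, except that the
  product of \<open>q\<close> and \<open>r\<close> in the corner is \<open>\<lambda>(q r)\<close>, where the linear functional \<open>\<lambda>\<close> sends \<open>x\<^sup>k\<close> to a
  weight \<open>w k\<close>, equal to 1 if \<open>k\<close> is a square and to 0 otherwise. Commutators lie in the ideal \<open>p = 0\<close>,
  whose cube vanishes, so the algebra is PI. It is generated by \<open>x\<close> and the matrix units \<open>e\<close> and \<open>f\<close> in
  the positions of \<open>q\<close> and \<open>r\<close>. Multiplication by \<open>x\<close> raises degrees, so the set of leading
  positions of an ideal is closed under a shift; such sets satisfy the ascending chain condition, and
  an ideal is determined by its leading positions within any larger one.

  In a matrix ring over a commutative ring, \<open>x\<close> would satisfy a monic equation of some degree \<open>N\<close>.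
  Multiplying it by \<open>e x\<^sup>k\<close> from the left and by \<open>f\<close> from the right shows that the elements
  \<open>e x\<^sup>k f = w k g\<close>, with \<open>g\<close> the corner unit, satisfy a linear recurrence of order \<open>N\<close>. As there are
  gaps of length at least \<open>N\<close> between squares, \<open>g\<close> would be mapped to 0.
\<close>

section \<open>Integrality of matrices over a commutative ring\<close>

abbreviation (in UP) cf :: "(nat \<Rightarrow> 'a) \<Rightarrow> nat \<Rightarrow> 'a"
  where "cf \<equiv> up_ring.coeff P"

abbreviation (in UP) mon :: "'a \<Rightarrow> nat \<Rightarrow> nat \<Rightarrow> 'a"
  where "mon \<equiv> up_ring.monom P"

section \<open>Linear functionals on polynomials, given by weights\<close>

context UP_cring
begin

text \<open>The functional with value \<open>w k\<close> at the k-th power of the variable. It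
  serves twice: as the corner product of the algebra, and to express recurrences, since
  \<open>lin (\<lambda>l. w (k + l)) q = \<zero>\<close> for all \<open>k\<close> says that
  \<open>w\<close> satisfies the linear recurrence with characteristic polynomial
  \<open>q\<close>.\<close>

definition lin :: "(nat \<Rightarrow> 'a) \<Rightarrow> (nat \<Rightarrow> 'a) \<Rightarrow> 'a"
  where "lin w p = (\<Oplus>i\<in>{..deg R p}. cf p i \<otimes> w i)"

text \<open>Any bound on the degree may replace \<open>deg\<close>, so that sums for several
  polynomials can be taken over a common range.\<close>

lemma lin_eq:
  assumes p: "p \<in> carrier P" and w: "\<And>i. w i \<in> carrier R"
    and b: "\<And>i. b < i \<Longrightarrow> cf p i = \<zero>"
  shows "lin w p = (\<Oplus>i\<in>{..b}. cf p i \<otimes> w i)"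
  unfolding lin_def
  by (rule R.add.finprod_mono_neutral_cong)
    (use assms in \<open>auto simp: not_le deg_aboveD\<close>)

lemma lin_closed [simp]:
  "\<lbrakk> p \<in> carrier P; \<And>i. w i \<in> carrier R \<rbrakk> \<Longrightarrow> lin w p \<in> carrier R"
  unfolding lin_def by (rule R.finsum_closed) auto

lemma lin_add:
  assumes p: "p \<in> carrier P" and q: "q \<in> carrier P" and w: "\<And>i. w i \<in> carrier R"
  shows "lin w (p \<oplus>\<^bsub>P\<^esub> q) = lin w p \<oplus> lin w q"
proof -
  let ?b = "max (deg R p) (deg R q)"
  have "lin w (p \<oplus>\<^bsub>P\<^esub> q) = (\<Oplus>i\<in>{..?b}. cf (p \<oplus>\<^bsub>P\<^esub> q) i \<otimes> w i)"
    by (rule lin_eq) (use assms in \<open>auto simp: deg_aboveD\<close>)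
  also have "\<dots> = (\<Oplus>i\<in>{..?b}. cf p i \<otimes> w i \<oplus> cf q i \<otimes> w i)"
    by (rule R.finsum_cong') (use assms in \<open>auto simp: R.l_distr\<close>)
  also have "\<dots> = (\<Oplus>i\<in>{..?b}. cf p i \<otimes> w i) \<oplus> (\<Oplus>i\<in>{..?b}. cf q i \<otimes> w i)"
    by (rule R.finsum_addf) (use assms in auto)
  also have "(\<Oplus>i\<in>{..?b}. cf p i \<otimes> w i) = lin w p"
    by (rule lin_eq[symmetric]) (use assms in \<open>auto simp: deg_aboveD\<close>)
  also have "(\<Oplus>i\<in>{..?b}. cf q i \<otimes> w i) = lin w q"
    by (rule lin_eq[symmetric]) (use assms in \<open>auto simp: deg_aboveD\<close>)
  finally show ?thesis .
qed

lemma lin_smult: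
  assumes p: "p \<in> carrier P" and a: "a \<in> carrier R" and w: "\<And>i. w i \<in> carrier R"
  shows "lin w (a \<odot>\<^bsub>P\<^esub> p) = a \<otimes> lin w p"
proof -
  have "lin w (a \<odot>\<^bsub>P\<^esub> p) = (\<Oplus>i\<in>{..deg R p}. cf (a \<odot>\<^bsub>P\<^esub> p) i \<otimes> w i)"
    by (rule lin_eq) (use assms in \<open>auto simp: deg_aboveD\<close>)
  also have "\<dots> = (\<Oplus>i\<in>{..deg R p}. a \<otimes> (cf p i \<otimes> w i))"
    by (rule R.finsum_cong') (use assms in \<open>auto simp: R.m_assoc\<close>)
  also have "\<dots> = a \<otimes> lin w p"
    unfolding lin_def by (rule R.finsum_rdistr[symmetric]) (use assms in auto)
  finally show ?thesis .
qed

lemma lin_monom: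
  assumes "a \<in> carrier R" and "\<And>i. w i \<in> carrier R"
  shows "lin w (mon a n) = a \<otimes> w n"
proof -
  have "lin w (mon a n) = (\<Oplus>i\<in>{..n}. cf (mon a n) i \<otimes> w i)"
    by (rule lin_eq) (use assms in auto)
  also have "\<dots> = (\<Oplus>i\<in>{..n}. if n = i then a \<otimes> w i else \<zero>)"
    by (rule R.finsum_cong') (use assms in auto)
  also have "\<dots> = a \<otimes> w n"
    by (rule R.finsum_singleton) (use assms in auto)
  finally show ?thesis .
qed

lemma coeff_X_mult:
  assumes "p \<in> carrier P"
  shows "cf (mon \<one> 1 \<otimes>\<^bsub>P\<^esub> p) n = (if n = 0 then \<zero> else cf p (n - 1))"
proof (cases n)
  case 0
  then show ?thesis using assms by simp
next
  case (Suc m)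
  have "cf (mon \<one> 1 \<otimes>\<^bsub>P\<^esub> p) (m + 1) = \<one> \<otimes> cf p m"
    using assms by (intro coeff_monom_mult) auto
  then show ?thesis using assms Suc by simp
qed

lemma coeff_mult_0:
  assumes "p \<in> carrier P" and "q \<in> carrier P"
  shows "cf (p \<otimes>\<^bsub>P\<^esub> q) 0 = cf p 0 \<otimes> cf q 0"
  using assms by simp

text \<open>Multiplication by the variable is adjoint to the shift of the weights: each coefficient
  moves up by one position and meets the next weight.\<close>

lemma lin_X_mult:
  assumes p: "p \<in> carrier P" and w: "\<And>i. w i \<in> carrier R"
  shows "lin w (mon \<one> 1 \<otimes>\<^bsub>P\<^esub> p) = lin (\<lambda>i. w (Suc i)) p"
proof -
  have c: "cf (mon \<one> 1 \<otimes>\<^bsub>P\<^esub> p) i = (if i = 0 then \<zero> else cf p (i - 1))" for i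
    by (rule coeff_X_mult[OF p])
  have "lin w (mon \<one> 1 \<otimes>\<^bsub>P\<^esub> p)
      = (\<Oplus>i\<in>{..Suc (deg R p)}. cf (mon \<one> 1 \<otimes>\<^bsub>P\<^esub> p) i \<otimes> w i)"
    by (rule lin_eq) (use assms in \<open>auto simp: c deg_aboveD simp del: coeff_mult One_nat_def\<close>)
  also have "\<dots> = (\<Oplus>i\<in>{..deg R p}. cf p i \<otimes> w (Suc i)) \<oplus> \<zero>"
    by (subst R.finsum_Suc2) (use assms in \<open>auto simp: c simp del: coeff_mult One_nat_def\<close>)
  finally show ?thesis using assms by (simp add: lin_def)
qed

lemma in_UP_iff: "p \<in> carrier P \<longleftrightarrow> (\<forall>i. p i \<in> carrier R) \<and> (\<exists>b. \<forall>i>b. p i = \<zero>)"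
  by (auto simp: P_def UP_def up_def bound_def Pi_def)

lemma cf_eq: "p \<in> carrier P \<Longrightarrow> cf p n = p n"
  unfolding P_def UP_def by simp

lemma add_eq: "\<lbrakk> p \<in> carrier P; q \<in> carrier P \<rbrakk> \<Longrightarrow> p \<oplus>\<^bsub>P\<^esub> q = (\<lambda>i. p i \<oplus> q i)"
  unfolding P_def UP_def by simp

lemma smult_eq: "\<lbrakk> a \<in> carrier R; p \<in> carrier P \<rbrakk> \<Longrightarrow> a \<odot>\<^bsub>P\<^esub> p = (\<lambda>i. a \<otimes> p i)"
  unfolding P_def UP_def by simp

lemma zero_eq: "\<zero>\<^bsub>P\<^esub> = (\<lambda>i. \<zero>)"
  unfolding P_def UP_def by simp

lemma smult_mult_right:
  "\<lbrakk> a \<in> carrier R; p \<in> carrier P; q \<in> carrier P \<rbrakk> \<Longrightarrow> p \<otimes>\<^bsub>P\<^esub> (a \<odot>\<^bsub>P\<^esub> q) = a \<odot>\<^bsub>P\<^esub> (p \<otimes>\<^bsub>P\<^esub> q)"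
  by (metis UP_m_comm UP_smult_assoc2 UP_smult_closed)

lemma lin_zero [simp]: "(\<And>i. w i \<in> carrier R) \<Longrightarrow> lin w \<zero>\<^bsub>P\<^esub> = \<zero>"
  by (simp add: lin_def)

section \<open>Monic polynomials annihilating the orbit of a matrix\<close>

definition lower :: "nat \<Rightarrow> (nat \<Rightarrow> 'a) \<Rightarrow> bool"
  where "lower d p \<longleftrightarrow> p \<in> carrier P \<and> (\<forall>i\<ge>d. cf p i = \<zero>)"

text \<open>Stated by coefficients rather than by \<open>deg\<close>, so that it also makes sense
  over the zero ring, where every degree is 0.\<close>

definition monic :: "nat \<Rightarrow> (nat \<Rightarrow> 'a) \<Rightarrow> bool"
  where "monic d p \<longleftrightarrow> p \<in> carrier P \<and> cf p d = \<one> \<and> (\<forall>i>d. cf p i = \<zero>)"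

text \<open>The bound on \<open>p\<close> is weak and that on \<open>q\<close> strict, which covers
  a monic as well as a lower first factor. For \<open>n \<ge> d + e\<close>, an index
  \<open>i \<le> d\<close> leaves \<open>n - i \<ge> e\<close>, so every term of the convolution
  vanishes.\<close>

lemma lower_mult:
  assumes "p \<in> carrier P" "\<And>i. d < i \<Longrightarrow> cf p i = \<zero>" "lower e q"
  shows "lower (d + e) (p \<otimes>\<^bsub>P\<^esub> q)"
proof -
  have "cf p i \<otimes> cf q (n - i) = \<zero>" if "n \<ge> d + e" for n i
    using assms that by (cases "i > d") (auto simp: lower_def)
  then show ?thesis using assms unfolding lower_def
    by (auto intro!: R.add.finprod_one_eqI)
qed

lemma monic_mult:
  assumes "monic d p" and "monic e q"
  shows "monic (d + e) (p \<otimes>\<^bsub>P\<^esub> q)"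
proof -
  have p: "p \<in> carrier P" and q: "q \<in> carrier P" using assms by (auto simp: monic_def)
  have z: "cf p i \<otimes> cf q (n - i) = \<zero>" if "n > d + e" for n i
    using assms that by (cases "i > d") (auto simp: monic_def)
  have "(\<Oplus>i\<in>{..d + e}. cf p i \<otimes> cf q (d + e - i))
      = (\<Oplus>i\<in>{..d + e}. if d = i then \<one> else \<zero>)"
  proof (rule R.finsum_cong')
    fix i
    show "cf p i \<otimes> cf q (d + e - i) = (if d = i then \<one> else \<zero>)"
      using assms by (cases "i > d"; cases "i = d") (auto simp: monic_def)
  qed auto
  also have "\<dots> = \<one>" by (rule R.finsum_singleton) auto
  finally have one: "(\<Oplus>i\<in>{..d + e}. cf p i \<otimes> cf q (d + e - i)) = \<one>" .
  show ?thesis unfolding monic_def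
    using p q one z by (auto intro!: R.add.finprod_one_eqI)
qed

lemma lower_minus: "\<lbrakk> lower d p; lower d q \<rbrakk> \<Longrightarrow> lower d (p \<ominus>\<^bsub>P\<^esub> q)"
  by (simp add: lower_def P.minus_eq)

lemma monic_minus: "\<lbrakk> monic d p; lower d q \<rbrakk> \<Longrightarrow> monic d (p \<ominus>\<^bsub>P\<^esub> q)"
  by (simp add: lower_def monic_def P.minus_eq)

text \<open>Linearity in the weights. By it, a recurrence shared by several sequences passes to
  their linear combinations.\<close>

lemma lin_sum_weights:
  assumes p: "p \<in> carrier P" and A: "finite A"
    and x: "\<And>j. j \<in> A \<Longrightarrow> x j \<in> carrier R"
    and u: "\<And>j k. j \<in> A \<Longrightarrow> u j k \<in> carrier R"
  shows "lin (\<lambda>k. \<Oplus>j\<in>A. x j \<otimes> u j k) p = (\<Oplus>j\<in>A. x j \<otimes> lin (u j) p)"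
  using A x u
proof (induction A)
  case empty
  then show ?case using p by (simp add: lin_def)
next
  case (insert a A)
  have "(\<lambda>k. \<Oplus>j\<in>insert a A. x j \<otimes> u j k) = (\<lambda>k. x a \<otimes> u a k \<oplus> (\<Oplus>j\<in>A. x j \<otimes> u j k))"
    using insert by (auto simp: fun_eq_iff)
  moreover have "lin (\<lambda>k. x a \<otimes> u a k \<oplus> (\<Oplus>j\<in>A. x j \<otimes> u j k)) p
      = (\<Oplus>i\<in>{..deg R p}. x a \<otimes> (cf p i \<otimes> u a i) \<oplus> cf p i \<otimes> (\<Oplus>j\<in>A. x j \<otimes> u j i))"
    unfolding lin_def
    by (rule R.finsum_cong') (use insert.prems p in \<open>auto simp: R.r_distr R.m_lcomm\<close>)
  moreover have "(\<Oplus>i\<in>{..deg R p}. x a \<otimes> (cf p i \<otimes> u a i) \<oplus> cf p i \<otimes> (\<Oplus>j\<in>A. x j \<otimes> u j i))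
      = (\<Oplus>i\<in>{..deg R p}. x a \<otimes> (cf p i \<otimes> u a i)) \<oplus> lin (\<lambda>k. \<Oplus>j\<in>A. x j \<otimes> u j k) p"
    unfolding lin_def by (rule R.finsum_addf) (use insert.prems p in auto)
  moreover have "(\<Oplus>i\<in>{..deg R p}. x a \<otimes> (cf p i \<otimes> u a i)) = x a \<otimes> lin (u a) p"
    unfolding lin_def by (rule R.finsum_rdistr[symmetric]) (use insert.prems p in auto)
  ultimately show ?case using insert p by simp
qed

text \<open>Iterated adjointness; it turns annihilation of all multiples of \<open>q\<close> into a
  recurrence valid from every starting index.\<close>

lemma lin_X_power_mult:
  assumes p: "p \<in> carrier P" and w: "\<And>i. w i \<in> carrier R"
  shows "lin w (mon \<one> k \<otimes>\<^bsub>P\<^esub> p) = lin (\<lambda>i. w (k + i)) p"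
  using w
proof (induction k arbitrary: w)
  case 0
  then show ?case using p by simp
next
  case (Suc k)
  have "mon \<one> (Suc k) \<otimes>\<^bsub>P\<^esub> p = mon \<one> 1 \<otimes>\<^bsub>P\<^esub> (mon \<one> k \<otimes>\<^bsub>P\<^esub> p)"
    unfolding monom_one_Suc2 using p by (intro P.m_assoc) auto
  then have "lin w (mon \<one> (Suc k) \<otimes>\<^bsub>P\<^esub> p) = lin (\<lambda>i. w (Suc i)) (mon \<one> k \<otimes>\<^bsub>P\<^esub> p)"
    using lin_X_mult[of "mon \<one> k \<otimes>\<^bsub>P\<^esub> p" w] p Suc.prems by simp
  also have "\<dots> = lin (\<lambda>i. w (Suc (k + i))) p" by (rule Suc.IH) (rule Suc.prems)
  finally show ?case by simp
qed

text \<open>Gaussian elimination without division. The matrix \<open>T\<close> has monic diagonal entries of degree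
  \<open>d\<close> and all other entries of smaller degree; replacing row \<open>i\<close> by
  \<open>T n n * row i - T i n * row n\<close> clears column \<open>n\<close> and keeps this shape, with \<open>2 * d\<close> for \<open>d\<close>.\<close>

lemma monic_annihilator:
  fixes L :: "nat \<Rightarrow> (nat \<Rightarrow> 'a) \<Rightarrow> 'a"
  assumes "\<And>j p. \<lbrakk> j < n; p \<in> carrier P \<rbrakk> \<Longrightarrow> L j p \<in> carrier R"
    and "\<And>j p q. \<lbrakk> j < n; p \<in> carrier P; q \<in> carrier P \<rbrakk> \<Longrightarrow> L j (p \<oplus>\<^bsub>P\<^esub> q) = L j p \<oplus> L j q"
    and "\<And>i. i < n \<Longrightarrow> monic d (T i i)"
    and "\<And>i j. \<lbrakk> i < n; j < n; i \<noteq> j \<rbrakk> \<Longrightarrow> lower d (T i j)"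
    and "\<And>i p. \<lbrakk> i < n; p \<in> carrier P \<rbrakk> \<Longrightarrow> (\<Oplus>j\<in>{..<n}. L j (T i j \<otimes>\<^bsub>P\<^esub> p)) = \<zero>"
  shows "\<exists>N q. monic N q \<and> (\<forall>j<n. \<forall>p\<in>carrier P. L j (q \<otimes>\<^bsub>P\<^esub> p) = \<zero>)"
  using assms
proof (induction n arbitrary: T d)
  case 0
  \<comment> \<open>No functional is left to annihilate, so the constant 1 serves.\<close>
  have "monic 0 \<one>\<^bsub>P\<^esub>" by (auto simp: monic_def)
  then show ?case by blast
next
  case (Suc n)
  note L = Suc.prems(1) and Ladd = Suc.prems(2) and rel = Suc.prems(5)
  have T: "T i j \<in> carrier P" if "i < Suc n" "j < Suc n" for i j
    using Suc.prems(3,4) that by (cases "i = j") (auto simp: monic_def lower_def)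
  have Lsub: "L j (p \<ominus>\<^bsub>P\<^esub> q) = L j p \<ominus> L j q" if "j < Suc n" "p \<in> carrier P" "q \<in> carrier P" for j p q
  proof -
    have "L j p = L j ((p \<ominus>\<^bsub>P\<^esub> q) \<oplus>\<^bsub>P\<^esub> q)"
      using that by (simp add: P.minus_eq P.a_assoc P.l_neg)
    also have "\<dots> = L j (p \<ominus>\<^bsub>P\<^esub> q) \<oplus> L j q" using that by (intro Ladd) auto
    finally show ?thesis using that L[of j] by (simp add: R.minus_eq R.a_assoc R.r_neg)
  qed
  \<comment> \<open>Relation \<open>i\<close>, solved for its term in column
    \<open>n\<close>.\<close>
  have split: "(\<Oplus>j\<in>{..<n}. L j (T i j \<otimes>\<^bsub>P\<^esub> p)) = \<ominus> L n (T i n \<otimes>\<^bsub>P\<^esub> p)"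
    if "i < Suc n" "p \<in> carrier P" for i p
  proof -
    have "L n (T i n \<otimes>\<^bsub>P\<^esub> p) \<oplus> (\<Oplus>j\<in>{..<n}. L j (T i j \<otimes>\<^bsub>P\<^esub> p)) = \<zero>"
      using rel[OF that] that T L by (simp add: lessThan_Suc)
    then show ?thesis using that T L
      by (intro R.minus_equality[symmetric]) (auto simp: R.a_comm)
  qed
  define T' where "T' i j = (T n n \<otimes>\<^bsub>P\<^esub> T i j) \<ominus>\<^bsub>P\<^esub> (T i n \<otimes>\<^bsub>P\<^esub> T n j)" for i j
  have Tn: "monic d (T n n)" and low: "\<And>i. i < n \<Longrightarrow> lower d (T i n)" "\<And>i. i < n \<Longrightarrow> lower d (T n i)"
    using Suc.prems(3,4) by auto
  have low2: "lower (d + d) (T i n \<otimes>\<^bsub>P\<^esub> T n j)" if "i < n" "j < n" for i j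
    using low that by (intro lower_mult) (auto simp: lower_def)
  have "\<exists>N q. monic N q \<and> (\<forall>j<n. \<forall>p\<in>carrier P. L j (q \<otimes>\<^bsub>P\<^esub> p) = \<zero>)"
  proof (rule Suc.IH[of "d + d" T'])
    fix i assume i: "i < n"
    show "monic (d + d) (T' i i)"
      unfolding T'_def using i Suc.prems(3) by (intro monic_minus monic_mult low2) auto
    fix p assume p: "p \<in> carrier P"
    have T'p: "T' i j \<otimes>\<^bsub>P\<^esub> p = (T i j \<otimes>\<^bsub>P\<^esub> (T n n \<otimes>\<^bsub>P\<^esub> p)) \<ominus>\<^bsub>P\<^esub> (T n j \<otimes>\<^bsub>P\<^esub> (T i n \<otimes>\<^bsub>P\<^esub> p))"
      if "j < n" for j
    proof -
      have "T i j \<in> carrier P" "T n j \<in> carrier P" "T i n \<in> carrier P" "T n n \<in> carrier P"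
        using T i that by auto
      then show ?thesis unfolding T'_def using p by algebra
    qed
    have "(\<Oplus>j\<in>{..<n}. L j (T' i j \<otimes>\<^bsub>P\<^esub> p))
        = (\<Oplus>j\<in>{..<n}. L j (T i j \<otimes>\<^bsub>P\<^esub> (T n n \<otimes>\<^bsub>P\<^esub> p)) \<oplus> \<ominus> L j (T n j \<otimes>\<^bsub>P\<^esub> (T i n \<otimes>\<^bsub>P\<^esub> p)))"
      by (rule R.finsum_cong') (use i p L T in \<open>auto simp: T'p Lsub R.minus_eq\<close>)
    also have "\<dots> = (\<Oplus>j\<in>{..<n}. L j (T i j \<otimes>\<^bsub>P\<^esub> (T n n \<otimes>\<^bsub>P\<^esub> p)))
        \<oplus> (\<Oplus>j\<in>{..<n}. \<ominus> L j (T n j \<otimes>\<^bsub>P\<^esub> (T i n \<otimes>\<^bsub>P\<^esub> p)))"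
      by (rule R.finsum_addf) (use i p L T in auto)
    also have "(\<Oplus>j\<in>{..<n}. \<ominus> L j (T n j \<otimes>\<^bsub>P\<^esub> (T i n \<otimes>\<^bsub>P\<^esub> p)))
        = (\<Oplus>j\<in>{..<n}. \<ominus> \<one> \<otimes> L j (T n j \<otimes>\<^bsub>P\<^esub> (T i n \<otimes>\<^bsub>P\<^esub> p)))"
      by (rule R.finsum_cong') (use i p L T in \<open>auto simp: R.l_minus\<close>)
    also have "\<dots> = \<ominus> \<one> \<otimes> (\<Oplus>j\<in>{..<n}. L j (T n j \<otimes>\<^bsub>P\<^esub> (T i n \<otimes>\<^bsub>P\<^esub> p)))"
      by (rule R.finsum_rdistr[symmetric]) (use i p L T in auto)
    also have "(\<Oplus>j\<in>{..<n}. L j (T i j \<otimes>\<^bsub>P\<^esub> (T n n \<otimes>\<^bsub>P\<^esub> p))) = \<ominus> L n (T i n \<otimes>\<^bsub>P\<^esub> (T n n \<otimes>\<^bsub>P\<^esub> p))"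
      by (rule split) (use i p T in auto)
    also have "(\<Oplus>j\<in>{..<n}. L j (T n j \<otimes>\<^bsub>P\<^esub> (T i n \<otimes>\<^bsub>P\<^esub> p))) = \<ominus> L n (T n n \<otimes>\<^bsub>P\<^esub> (T i n \<otimes>\<^bsub>P\<^esub> p))"
      by (rule split) (use i p T in auto)
    \<comment> \<open>The two terms removed from column \<open>n\<close> agree because polynomials
      commute, so they cancel.\<close>
    also have "T i n \<otimes>\<^bsub>P\<^esub> (T n n \<otimes>\<^bsub>P\<^esub> p) = T n n \<otimes>\<^bsub>P\<^esub> (T i n \<otimes>\<^bsub>P\<^esub> p)"
      using i p T by (intro P.m_lcomm) auto
    finally show "(\<Oplus>j\<in>{..<n}. L j (T' i j \<otimes>\<^bsub>P\<^esub> p)) = \<zero>"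
      using i p T L by (simp add: R.l_minus R.l_neg)
  next
    fix i j assume ij: "i < n" "j < n" "i \<noteq> j"
    then have "lower (d + d) (T n n \<otimes>\<^bsub>P\<^esub> T i j)"
      using Tn Suc.prems(4) by (intro lower_mult) (auto simp: monic_def)
    then show "lower (d + d) (T' i j)"
      unfolding T'_def using low2 ij by (intro lower_minus) auto
  qed (use L Ladd in auto)
  then obtain N q where q: "monic N q" and ann: "\<And>j p. j < n \<Longrightarrow> p \<in> carrier P \<Longrightarrow> L j (q \<otimes>\<^bsub>P\<^esub> p) = \<zero>"
    by blast
  have qc: "q \<in> carrier P" and Tc: "T n n \<in> carrier P" using q T by (auto simp: monic_def)
  \<comment> \<open>The annihilator is \<open>q\<close> times the pivot \<open>T n n\<close>. For
    \<open>j < n\<close> the factor \<open>q\<close> suffices; for \<open>j = n\<close>, relation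
    \<open>n\<close> expresses the value through the functionals below \<open>n\<close>, all killed
    by \<open>q\<close>.\<close>
  have "L j ((q \<otimes>\<^bsub>P\<^esub> T n n) \<otimes>\<^bsub>P\<^esub> p) = \<zero>" if "j < Suc n" and p: "p \<in> carrier P" for j p
  proof (cases "j = n")
    case False
    then show ?thesis using that ann[of j "T n n \<otimes>\<^bsub>P\<^esub> p"] qc Tc by (simp add: P.m_assoc)
  next
    case True
    have "(\<Oplus>j\<in>{..<n}. L j (T n j \<otimes>\<^bsub>P\<^esub> (q \<otimes>\<^bsub>P\<^esub> p))) = \<zero>"
    proof (rule R.add.finprod_one_eqI)
      fix j assume "j \<in> {..<n}"
      then show "L j (T n j \<otimes>\<^bsub>P\<^esub> (q \<otimes>\<^bsub>P\<^esub> p)) = \<zero>"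
        using ann[of j "T n j \<otimes>\<^bsub>P\<^esub> p"] qc p T by (simp add: P.m_lcomm)
    qed
    then have "\<ominus> L n (T n n \<otimes>\<^bsub>P\<^esub> (q \<otimes>\<^bsub>P\<^esub> p)) = \<zero>"
      using split[of n "q \<otimes>\<^bsub>P\<^esub> p"] qc p by simp
    then have "L n (T n n \<otimes>\<^bsub>P\<^esub> (q \<otimes>\<^bsub>P\<^esub> p)) = \<zero>"
      using L[of n "T n n \<otimes>\<^bsub>P\<^esub> (q \<otimes>\<^bsub>P\<^esub> p)"] qc p Tc by (metis R.minus_minus R.minus_zero P.m_closed lessI)
    then show ?thesis using True qc Tc p by (simp add: P.m_assoc P.m_lcomm)
  qed
  then show ?case using monic_mult[OF q Tn] by blast
qed

text \<open>A substitute for the Cayley-Hamilton theorem. The vectors \<open>v _ k\<close> form an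
  orbit under \<open>x\<close>, so the characteristic matrix of \<open>x\<close>, with the variable
  acting as the shift, gives relations between the functionals \<open>lin (v j)\<close>. Elimination
  turns them into one monic recurrence for all coordinates.\<close>

lemma matrix_orbit_recurrence:
  fixes v :: "nat \<Rightarrow> nat \<Rightarrow> 'a"
  assumes v: "\<And>i k. i < n \<Longrightarrow> v i k \<in> carrier R"
    and x: "\<And>i j. \<lbrakk> i < n; j < n \<rbrakk> \<Longrightarrow> x i j \<in> carrier R"
    and step: "\<And>i k. i < n \<Longrightarrow> v i (Suc k) = (\<Oplus>j\<in>{..<n}. x i j \<otimes> v j k)"
  shows "\<exists>N q. monic N q \<and> (\<forall>j<n. \<forall>k. lin (\<lambda>l. v j (k + l)) q = \<zero>)"
proof -
  \<comment> \<open>The characteristic matrix: monic of degree 1 on the diagonal and constant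
    elsewhere, the shape required with \<open>d = 1\<close>.\<close>
  define T where "T i j = (if i = j then mon \<one> 1 else \<zero>\<^bsub>P\<^esub>) \<ominus>\<^bsub>P\<^esub> mon (x i j) 0" for i j
  have "\<exists>N q. monic N q \<and> (\<forall>j<n. \<forall>p\<in>carrier P. lin (v j) (q \<otimes>\<^bsub>P\<^esub> p) = \<zero>)"
  proof (rule monic_annihilator[where T = T and d = 1])
    fix i assume i: "i < n"
    show "monic 1 (T i i)"
      using i x unfolding T_def by (intro monic_minus) (auto simp: monic_def lower_def)
    fix p assume p: "p \<in> carrier P"
    have L: "lin (v j) (T i j \<otimes>\<^bsub>P\<^esub> p)
        = (if i = j then lin (\<lambda>k. v j (Suc k)) p else \<zero>) \<oplus> \<ominus> \<one> \<otimes> (x i j \<otimes> lin (v j) p)" if "j < n" for j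
    proof -
      have "T i j \<otimes>\<^bsub>P\<^esub> p = (if i = j then mon \<one> 1 \<otimes>\<^bsub>P\<^esub> p else \<zero>\<^bsub>P\<^esub>) \<oplus>\<^bsub>P\<^esub> (\<ominus> x i j) \<odot>\<^bsub>P\<^esub> p"
        using i that x p
        by (simp add: T_def P.minus_eq P.l_distr monom_mult_is_smult del: monom_a_inv add: monom_a_inv[symmetric])
      moreover have "lin (v j) \<zero>\<^bsub>P\<^esub> = \<zero>" using v that by simp
      ultimately show ?thesis using i that x v p
        by (simp add: lin_add lin_smult lin_X_mult[simplified] R.l_minus)
    qed
    have "(\<Oplus>j\<in>{..<n}. lin (v j) (T i j \<otimes>\<^bsub>P\<^esub> p))
      = (\<Oplus>j\<in>{..<n}. (if i = j then lin (\<lambda>k. v j (Suc k)) p else \<zero>) \<oplus> \<ominus> \<one> \<otimes> (x i j \<otimes> lin (v j) p))"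
      by (rule R.finsum_cong') (use i v x p in \<open>auto simp: L\<close>)
    also have "\<dots> = (\<Oplus>j\<in>{..<n}. if i = j then lin (\<lambda>k. v j (Suc k)) p else \<zero>)
        \<oplus> (\<Oplus>j\<in>{..<n}. \<ominus> \<one> \<otimes> (x i j \<otimes> lin (v j) p))"
      by (rule R.finsum_addf) (use i v x p in auto)
    also have "(\<Oplus>j\<in>{..<n}. if i = j then lin (\<lambda>k. v j (Suc k)) p else \<zero>) = lin (\<lambda>k. v i (Suc k)) p"
      by (rule R.finsum_singleton) (use i v p in auto)
    also have "(\<Oplus>j\<in>{..<n}. \<ominus> \<one> \<otimes> (x i j \<otimes> lin (v j) p)) = \<ominus> \<one> \<otimes> (\<Oplus>j\<in>{..<n}. x i j \<otimes> lin (v j) p)"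
      by (rule R.finsum_rdistr[symmetric]) (use i v x p in auto)
    also have "(\<Oplus>j\<in>{..<n}. x i j \<otimes> lin (v j) p) = lin (\<lambda>k. v i (Suc k)) p"
      \<comment> \<open>By \<open>step\<close>, the combination of the \<open>v j\<close> with
        coefficients \<open>x i j\<close> is the shift of \<open>v i\<close>.\<close>
      using lin_sum_weights[of p "{..<n}" "x i" v] i v x p step by simp
    finally show "(\<Oplus>j\<in>{..<n}. lin (v j) (T i j \<otimes>\<^bsub>P\<^esub> p)) = \<zero>"
      using i v p by (simp add: R.l_minus R.r_neg)
  next
    fix i j assume "i < n" "j < n" "i \<noteq> j"
    then show "lower 1 (T i j)" using x by (auto simp: T_def lower_def P.minus_eq)
  qed (use v in \<open>auto simp: lin_add\<close>)
  then obtain N q where q: "monic N q" and ann: "\<And>j p. j < n \<Longrightarrow> p \<in> carrier P \<Longrightarrow> lin (v j) (q \<otimes>\<^bsub>P\<^esub> p) = \<zero>"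
    by blast
  \<comment> \<open>Testing with the powers of the variable gives the recurrence from every starting
    index \<open>k\<close>.\<close>
  have "lin (\<lambda>l. v j (k + l)) q = \<zero>" if "j < n" for j k
    using ann[OF that, of "mon \<one> k"] lin_X_power_mult[of q "v j" k] q v that
    by (simp add: monic_def P.m_comm)
  then show ?thesis using q by blast
qed

end


section \<open>Leading positions, chains and identities\<close>

context UP_cring
begin

text \<open>The analogue of the set of leading monomials in the theory of Groebner bases. A position
  will encode both a matrix entry and a degree.\<close>

definition leads :: "(nat \<Rightarrow> 'a) set \<Rightarrow> nat set"
  where "leads V = {n. \<exists>h\<in>V. h n \<noteq> \<zero> \<and> (\<forall>i>n. h i = \<zero>)}"

lemma leads_mono: "V \<subseteq> W \<Longrightarrow> leads V \<subseteq> leads W"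
  by (auto simp: leads_def)

text \<open>Division with remainder: the top coefficient of an element of \<open>W\<close> is
  cancelled by a multiple of an element of \<open>V\<close> with the same top position. The
  remainder lies in \<open>W\<close> and has a smaller top position, so induction applies.\<close>

lemma subset_of_leads_subset:
  assumes F: "field R" and V: "V \<subseteq> carrier P" and W: "W \<subseteq> carrier P" and sub: "V \<subseteq> W"
    and zero: "\<zero>\<^bsub>P\<^esub> \<in> V"
    and addV: "\<And>h k. \<lbrakk> h \<in> V; k \<in> V \<rbrakk> \<Longrightarrow> h \<oplus>\<^bsub>P\<^esub> k \<in> V"
    and smultV: "\<And>a h. \<lbrakk> a \<in> carrier R; h \<in> V \<rbrakk> \<Longrightarrow> a \<odot>\<^bsub>P\<^esub> h \<in> V"
    and addW: "\<And>h k. \<lbrakk> h \<in> W; k \<in> W \<rbrakk> \<Longrightarrow> h \<oplus>\<^bsub>P\<^esub> k \<in> W"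
    and smultW: "\<And>a h. \<lbrakk> a \<in> carrier R; h \<in> W \<rbrakk> \<Longrightarrow> a \<odot>\<^bsub>P\<^esub> h \<in> W"
    and leads: "leads W \<subseteq> leads V"
  shows "W \<subseteq> V"
proof -
  interpret F: field R by fact
  have "h \<in> V" if "h \<in> W" "\<forall>i\<ge>n. h i = \<zero>" for h n
    using that
  proof (induction n arbitrary: h)
    case 0
    then have "h = \<zero>\<^bsub>P\<^esub>" by (auto simp: zero_eq)
    then show ?case using zero by simp
  next
    case (Suc n)
    have hP: "h \<in> carrier P" using Suc.prems W by blast
    show ?case
    proof (cases "h n = \<zero>")
      case True
      then have "\<forall>i\<ge>n. h i = \<zero>" using Suc.prems(2) by (metis le_antisym not_less_eq_eq)
      then show ?thesis using Suc by blast
    next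
      case False
      then have "n \<in> leads W" using Suc.prems by (auto simp: leads_def Suc_le_eq)
      then obtain k where k: "k \<in> V" "k n \<noteq> \<zero>" "\<forall>i>n. k i = \<zero>"
        using leads by (auto simp: leads_def)
      have kP: "k \<in> carrier P" using k V by blast
      have el: "h i \<in> carrier R" "k i \<in> carrier R" for i using hP kP in_UP_iff by auto
      \<comment> \<open>The quotient of the leading coefficients; here division in the field is
        used.\<close>
      define c where "c = h n \<otimes> inv (k n)"
      have u: "k n \<in> Units R" using el k(2) by (simp add: F.field_Units)
      then have c: "c \<in> carrier R" "c \<otimes> k n = h n"
        using el by (auto simp: c_def R.m_assoc)
      define h' where "h' = h \<oplus>\<^bsub>P\<^esub> (\<ominus> c) \<odot>\<^bsub>P\<^esub> k"
      have h'_eq: "h' i = h i \<oplus> \<ominus> c \<otimes> k i" for i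
        using c hP kP by (simp add: h'_def add_eq fun_cong[OF smult_eq])
      have "h' \<in> W" unfolding h'_def using c k sub Suc.prems by (intro addW smultW) auto
      moreover have "h' i = \<zero>" if "i \<ge> n" for i
      proof (cases "i = n")
        case True
        then show ?thesis using c el[of n] by (simp add: h'_eq R.l_minus R.r_neg)
      next
        case False
        then show ?thesis using that Suc.prems(2) k(3) c by (simp add: h'_eq)
      qed
      ultimately have "h' \<in> V" using Suc.IH by blast
      then have "h' \<oplus>\<^bsub>P\<^esub> c \<odot>\<^bsub>P\<^esub> k \<in> V" using c k by (intro addV smultV)
      also have "h' \<oplus>\<^bsub>P\<^esub> c \<odot>\<^bsub>P\<^esub> k = h"
        using c hP kP by (simp add: h'_def P.a_assoc UP_smult_l_distr[symmetric] R.l_neg)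
      finally show ?thesis .
    qed
  qed
  moreover have "\<exists>n. \<forall>i\<ge>n. h i = \<zero>" if "h \<in> W" for h
    using that W in_UP_iff by (meson Suc_le_eq subsetD)
  ultimately show ?thesis by blast
qed

end

text \<open>The identity is the cube of the commutator of two variables, expanded into eight words.
  These are distinct, so no coefficients cancel, even in characteristic 2.\<close>

lemma (in assoc_algebra) PI_algebra_commutator_cube:
  assumes one: "\<one>\<^bsub>R\<^esub> \<noteq> \<zero>\<^bsub>R\<^esub>"
    and cube: "\<And>x y. \<lbrakk> x \<in> carrier M; y \<in> carrier M \<rbrakk> \<Longrightarrow>
      (x \<otimes> y \<ominus> y \<otimes> x) \<otimes> (x \<otimes> y \<ominus> y \<otimes> x) \<otimes> (x \<otimes> y \<ominus> y \<otimes> x) = \<zero>"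
  shows "PI_algebra R M"
proof -
  let ?u = "[0, 1] :: nat list" and ?v = "[1, 0] :: nat list"
  \<comment> \<open>The sign of a word is the parity of its number of factors \<open>?v\<close>:
    even in \<open>Wp\<close>, odd in \<open>Wm\<close>.\<close>
  define Wp where "Wp = {?u @ ?u @ ?u, ?u @ ?v @ ?v, ?v @ ?u @ ?v, ?v @ ?v @ ?u}"
  define Wm where "Wm = {?u @ ?u @ ?v, ?u @ ?v @ ?u, ?v @ ?u @ ?u, ?v @ ?v @ ?v}"
  define f where "f w = (if w \<in> Wp then \<one>\<^bsub>R\<^esub> else if w \<in> Wm then \<ominus>\<^bsub>R\<^esub> \<one>\<^bsub>R\<^esub> else \<zero>\<^bsub>R\<^esub>)" for w
  have disj: "Wp \<inter> Wm = {}" by (auto simp: Wp_def Wm_def)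
  have neg: "\<ominus>\<^bsub>R\<^esub> \<one>\<^bsub>R\<^esub> \<noteq> \<zero>\<^bsub>R\<^esub>"
    using one by (metis R.minus_minus R.minus_zero R.one_closed)
  have supp: "{w. f w \<noteq> \<zero>\<^bsub>R\<^esub>} = Wp \<union> Wm"
    using one neg by (auto simp: f_def)
  have fin: "finite Wp" "finite Wm" by (simp_all add: Wp_def Wm_def)
  have "f \<in> nc_polys R"
    unfolding nc_polys_def mem_Collect_eq supp using fin by (simp add: f_def)
  moreover have "f \<noteq> (\<lambda>w. \<zero>\<^bsub>R\<^esub>)"
  proof
    assume "f = (\<lambda>w. \<zero>\<^bsub>R\<^esub>)"
    then have "f (?u @ ?u @ ?u) = \<zero>\<^bsub>R\<^esub>" by simp
    then show False using one by (simp add: f_def Wp_def)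
  qed
  moreover have "nc_poly_eval R M f x = \<zero>" if x: "\<And>i. x i \<in> carrier M" for x
  proof -
    let ?e = "nc_word_eval M x"
    have e: "?e w \<in> carrier M" for w
      unfolding nc_word_eval_def using x by (induction w) auto
    define a b where "a = x 0 \<otimes> x 1" and "b = x 1 \<otimes> x 0"
    have ab: "a \<in> carrier M" "b \<in> carrier M" using x by (simp_all add: a_def b_def)
    have "nc_poly_eval R M f x = (\<Oplus>w\<in>Wp. f w \<odot>\<^bsub>M\<^esub> ?e w) \<oplus> (\<Oplus>w\<in>Wm. f w \<odot>\<^bsub>M\<^esub> ?e w)"
      unfolding nc_poly_eval_def supp
      by (rule finsum_Un_disjoint) (use fin disj e in \<open>auto simp: f_def\<close>)
    also have "(\<Oplus>w\<in>Wp. f w \<odot>\<^bsub>M\<^esub> ?e w) = (\<Oplus>w\<in>Wp. ?e w)"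
      by (rule finsum_cong') (use e in \<open>auto simp: f_def\<close>)
    also have "(\<Oplus>w\<in>Wm. f w \<odot>\<^bsub>M\<^esub> ?e w) = (\<Oplus>w\<in>Wm. \<ominus> ?e w)"
      by (rule finsum_cong') (use e disj in \<open>auto simp: f_def smult_l_minus\<close>)
    also have "(\<Oplus>w\<in>Wp. ?e w) = a \<otimes> (a \<otimes> a) \<oplus> (a \<otimes> (b \<otimes> b) \<oplus> (b \<otimes> (a \<otimes> b) \<oplus> b \<otimes> (b \<otimes> a)))"
      unfolding Wp_def by (simp add: nc_word_eval_def a_def b_def m_assoc x)
    also have "(\<Oplus>w\<in>Wm. \<ominus> ?e w) = \<ominus> (a \<otimes> (a \<otimes> b)) \<oplus> (\<ominus> (a \<otimes> (b \<otimes> a)) \<oplus> (\<ominus> (b \<otimes> (a \<otimes> a)) \<oplus> \<ominus> (b \<otimes> (b \<otimes> b))))"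
      unfolding Wm_def by (simp add: nc_word_eval_def a_def b_def m_assoc x)
    also have "a \<otimes> (a \<otimes> a) \<oplus> (a \<otimes> (b \<otimes> b) \<oplus> (b \<otimes> (a \<otimes> b) \<oplus> b \<otimes> (b \<otimes> a)))
        \<oplus> (\<ominus> (a \<otimes> (a \<otimes> b)) \<oplus> (\<ominus> (a \<otimes> (b \<otimes> a)) \<oplus> (\<ominus> (b \<otimes> (a \<otimes> a)) \<oplus> \<ominus> (b \<otimes> (b \<otimes> b)))))
        = (a \<ominus> b) \<otimes> (a \<ominus> b) \<otimes> (a \<ominus> b)"
      using ab by algebra
    also have "\<dots> = \<zero>" using cube[of "x 0" "x 1"] x by (simp add: a_def b_def)
    finally show ?thesis .
  qed
  ultimately show ?thesis unfolding PI_algebra_def by blast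
qed

text \<open>In each residue class modulo \<open>d\<close>, the smallest positive element that ever
  occurs yields all larger ones by shifts, so the class stops growing once this element is present.
  Position 0, to which \<open>shift\<close> does not apply, forms a class of its own.\<close>

lemma chain_of_shift_closed_sets_stabilizes:
  fixes D :: "nat \<Rightarrow> nat set"
  assumes mono: "\<And>k. D k \<subseteq> D (Suc k)" and d: "d > 0"
    and shift: "\<And>k n. \<lbrakk> n \<in> D k; n > 0 \<rbrakk> \<Longrightarrow> n + d \<in> D k"
  shows "\<exists>N. \<forall>k. D k \<subseteq> D N"
proof -
  have le: "D i \<subseteq> D j" if "i \<le> j" for i j
    using that mono by (rule lift_Suc_mono_le[of D, rotated])
  define K where "K = insert {0} ((\<lambda>r. {n. 0 < n \<and> n mod d = r}) ` {..<d})"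
  have "\<exists>N. \<forall>k. D k \<inter> S \<subseteq> D N" if "S \<in> K" for S
  proof (cases "\<exists>n k. n \<in> D k \<inter> S")
    case False
    then show ?thesis by blast
  next
    case True
    \<comment> \<open>The minimum is taken over all members of the chain at once.\<close>
    define m where "m = (LEAST n. \<exists>k. n \<in> D k \<inter> S)"
    have "\<exists>k. m \<in> D k \<inter> S" unfolding m_def using True by (rule LeastI_ex)
    then obtain N where N: "m \<in> D N" "m \<in> S" by blast
    have "n \<in> D N" if n: "n \<in> D k \<inter> S" for n k
    proof (cases "0 < m")
      case False
      then show ?thesis using N \<open>S \<in> K\<close> n by (auto simp: K_def)
    next
      case pos: True
      have "m \<le> n" unfolding m_def using n by (intro Least_le) blast
      moreover have "n mod d = m mod d" using \<open>S \<in> K\<close> n N pos by (auto simp: K_def)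
      ultimately obtain t where t: "n = m + d * t" by (metis mod_eq_nat2E mult.commute)
      have "m + d * t \<in> D N" for t
      proof (induction t)
        case 0
        then show ?case using N by simp
      next
        case (Suc t)
        then have "m + d * t + d \<in> D N" using pos by (intro shift) auto
        then show ?case by (simp add: ac_simps)
      qed
      then show ?thesis using t by simp
    qed
    then show ?thesis by blast
  qed
  then obtain N where N: "\<And>S k. S \<in> K \<Longrightarrow> D k \<inter> S \<subseteq> D (N S)" by metis
  \<comment> \<open>There are finitely many classes, so one index serves all of them.\<close>
  have "finite K" unfolding K_def by simp
  then have "D k \<inter> S \<subseteq> D (Max (N ` K))" if "S \<in> K" for S k
    using N[OF that, of k] le[of "N S" "Max (N ` K)"] that by auto
  moreover have "\<exists>S\<in>K. n \<in> S" for n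
    using d mod_less_divisor[OF d, of n] by (cases "n = 0") (auto simp: K_def)
  ultimately show ?thesis by blast
qed


section \<open>The algebra\<close>

text \<open>A matrix with entries \<open>p, q, r, s\<close> is encoded as one sequence with the coefficients of \<open>p, q, r\<close>
  interleaved, so that the algebra has the additive group of a polynomial ring.\<close>

definition pack :: "(nat \<Rightarrow> 'a) \<Rightarrow> (nat \<Rightarrow> 'a) \<Rightarrow> (nat \<Rightarrow> 'a) \<Rightarrow> 'a \<Rightarrow> nat \<Rightarrow> 'a"
  where "pack p q r s n = (case n of 0 \<Rightarrow> s | Suc m \<Rightarrow>
    (if m mod 3 = 0 then p else if m mod 3 = 1 then q else r) (m div 3))"

text \<open>Selectors inverse to \<open>pack\<close>. Position 0 is reserved for the corner
  \<open>s\<close>, so \<open>col\<close> starts at 3.\<close>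

definition diag :: "(nat \<Rightarrow> 'a) \<Rightarrow> nat \<Rightarrow> 'a" where "diag h m = h (3 * m + 1)"
definition row :: "(nat \<Rightarrow> 'a) \<Rightarrow> nat \<Rightarrow> 'a" where "row h m = h (3 * m + 2)"
definition col :: "(nat \<Rightarrow> 'a) \<Rightarrow> nat \<Rightarrow> 'a" where "col h m = h (3 * m + 3)"

lemma pack_sel [simp]:
  "diag (pack p q r s) = p" "row (pack p q r s) = q" "col (pack p q r s) = r" "pack p q r s 0 = s"
proof -
  have "Suc (3 * m) div 3 = m" "Suc (Suc (3 * m)) div 3 = m" "Suc (Suc (3 * m)) mod 3 = 2"
    for m :: nat by presburger+
  then have "pack p q r s (Suc (3 * m)) = p m" "pack p q r s (Suc (Suc (3 * m))) = q m"
    "pack p q r s (Suc (Suc (Suc (3 * m)))) = r m" for m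
    by (simp_all add: pack_def)
  then show "diag (pack p q r s) = p" "row (pack p q r s) = q" "col (pack p q r s) = r"
    by (simp_all add: diag_def row_def col_def fun_eq_iff numeral_2_eq_2 numeral_3_eq_3)
qed (simp add: pack_def)

lemma nat_pack_cases:
  obtains "n = 0" | m where "n = 3 * m + 1" | m where "n = 3 * m + 2" | m where "n = 3 * m + (3::nat)"
proof -
  have "n = 0 \<or> (\<exists>m. n = 3 * m + 1) \<or> (\<exists>m. n = 3 * m + 2) \<or> (\<exists>m. n = 3 * m + 3)" by presburger
  then show thesis using that by blast
qed

lemma pack_apply:
  "pack p q r s (3 * m + 1) = p m" "pack p q r s (3 * m + 2) = q m" "pack p q r s (3 * m + 3) = r m"
  using pack_sel(1-3)[of p q r s, THEN fun_cong, of m] unfolding diag_def row_def col_def by simp_all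

lemma pack_eqI:
  assumes "diag h = diag k" "row h = row k" "col h = col k" "h 0 = k 0"
  shows "h = k"
proof
  fix n
  show "h n = k n"
    by (rule nat_pack_cases[of n])
      (use assms in \<open>auto simp: diag_def row_def col_def fun_eq_iff\<close>)
qed

section \<open>The twisted matrix algebra for an arbitrary weight\<close>

locale pairing_algebra = UP_cring +
  fixes w :: "nat \<Rightarrow> 'a"
  assumes w_closed [simp]: "w i \<in> carrier R"
begin

lemma pack_closed [simp]:
  assumes "p \<in> carrier P" "q \<in> carrier P" "r \<in> carrier P" "s \<in> carrier R"
  shows "pack p q r s \<in> carrier P"
proof -
  obtain b1 b2 b3 where b: "\<forall>i>b1. p i = \<zero>" "\<forall>i>b2. q i = \<zero>" "\<forall>i>b3. r i = \<zero>"
    using assms in_UP_iff by metis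
  have "pack p q r s i = \<zero>" if i: "i > 3 * (b1 + b2 + b3 + 2)" for i
  proof (cases i rule: nat_pack_cases)
    case 1
    then show ?thesis using i by simp
  next
    case (2 m)
    then have "m > b1" using i by presburger
    then show ?thesis using b(1) 2 by (simp only: pack_apply)
  next
    case (3 m)
    then have "m > b2" using i by presburger
    then show ?thesis using b(2) 3 by (simp only: pack_apply)
  next
    case (4 m)
    then have "m > b3" using i by presburger
    then show ?thesis using b(3) 4 by (simp only: pack_apply)
  qed
  moreover have "\<forall>i. pack p q r s i \<in> carrier R"
    using assms unfolding in_UP_iff by (auto simp: pack_def split: nat.split)
  ultimately show ?thesis unfolding in_UP_iff by blast
qed

lemma sel_closed [simp]:
  assumes "h \<in> carrier P"
  shows "diag h \<in> carrier P" "row h \<in> carrier P" "col h \<in> carrier P" "h 0 \<in> carrier R"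
proof -
  obtain b where b: "\<forall>i>b. h i = \<zero>" using assms in_UP_iff by metis
  then have "\<forall>i>b. diag h i = \<zero>" "\<forall>i>b. row h i = \<zero>" "\<forall>i>b. col h i = \<zero>"
    by (auto simp: diag_def row_def col_def)
  then show "diag h \<in> carrier P" "row h \<in> carrier P" "col h \<in> carrier P" "h 0 \<in> carrier R"
    using assms unfolding in_UP_iff by (auto simp: diag_def row_def col_def)
qed

lemma sel_add [simp]:
  assumes "h \<in> carrier P" "k \<in> carrier P"
  shows "diag (h \<oplus>\<^bsub>P\<^esub> k) = diag h \<oplus>\<^bsub>P\<^esub> diag k" "row (h \<oplus>\<^bsub>P\<^esub> k) = row h \<oplus>\<^bsub>P\<^esub> row k"
    "col (h \<oplus>\<^bsub>P\<^esub> k) = col h \<oplus>\<^bsub>P\<^esub> col k" "(h \<oplus>\<^bsub>P\<^esub> k) 0 = h 0 \<oplus> k 0"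
  using sel_closed[OF assms(1)] sel_closed[OF assms(2)] assms
  by (simp_all add: add_eq) (simp_all add: diag_def row_def col_def fun_eq_iff)

lemma sel_smult [simp]:
  assumes "a \<in> carrier R" "h \<in> carrier P"
  shows "diag (a \<odot>\<^bsub>P\<^esub> h) = a \<odot>\<^bsub>P\<^esub> diag h" "row (a \<odot>\<^bsub>P\<^esub> h) = a \<odot>\<^bsub>P\<^esub> row h"
    "col (a \<odot>\<^bsub>P\<^esub> h) = a \<odot>\<^bsub>P\<^esub> col h" "(a \<odot>\<^bsub>P\<^esub> h) 0 = a \<otimes> h 0"
  using sel_closed[OF assms(2)] assms
  by (simp_all add: smult_eq) (simp_all add: diag_def row_def col_def fun_eq_iff)

lemma sel_zero [simp]:
  "diag \<zero>\<^bsub>P\<^esub> = \<zero>\<^bsub>P\<^esub>" "row \<zero>\<^bsub>P\<^esub> = \<zero>\<^bsub>P\<^esub>" "col \<zero>\<^bsub>P\<^esub> = \<zero>\<^bsub>P\<^esub>" "\<zero>\<^bsub>P\<^esub> 0 = \<zero>"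
  by (simp_all add: zero_eq diag_def row_def col_def fun_eq_iff)

text \<open>The scalars \<open>cf (diag h) 0\<close> and \<open>cf (diag k) 0\<close> are the outer
  diagonal entries, the values at 0 of the middle ones.\<close>

definition alg_mult :: "(nat \<Rightarrow> 'a) \<Rightarrow> (nat \<Rightarrow> 'a) \<Rightarrow> nat \<Rightarrow> 'a"
  where "alg_mult h k = pack (diag h \<otimes>\<^bsub>P\<^esub> diag k)
    (cf (diag h) 0 \<odot>\<^bsub>P\<^esub> row k \<oplus>\<^bsub>P\<^esub> row h \<otimes>\<^bsub>P\<^esub> diag k)
    (diag h \<otimes>\<^bsub>P\<^esub> col k \<oplus>\<^bsub>P\<^esub> cf (diag k) 0 \<odot>\<^bsub>P\<^esub> col h)
    (cf (diag h) 0 \<otimes> k 0 \<oplus> lin w (row h \<otimes>\<^bsub>P\<^esub> col k) \<oplus> cf (diag k) 0 \<otimes> h 0)"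

definition alg :: "('a, nat \<Rightarrow> 'a) module"
  where "alg = \<lparr>carrier = carrier P, monoid.mult = alg_mult,
    one = pack \<one>\<^bsub>P\<^esub> \<zero>\<^bsub>P\<^esub> \<zero>\<^bsub>P\<^esub> \<zero>, ring.zero = \<zero>\<^bsub>P\<^esub>, ring.add = (\<oplus>\<^bsub>P\<^esub>), smult = (\<odot>\<^bsub>P\<^esub>)\<rparr>"

lemma alg_sel [simp]:
  "carrier alg = carrier P" "\<zero>\<^bsub>alg\<^esub> = \<zero>\<^bsub>P\<^esub>" "h \<oplus>\<^bsub>alg\<^esub> k = h \<oplus>\<^bsub>P\<^esub> k" "a \<odot>\<^bsub>alg\<^esub> h = a \<odot>\<^bsub>P\<^esub> h"
  "h \<otimes>\<^bsub>alg\<^esub> k = alg_mult h k" "\<one>\<^bsub>alg\<^esub> = pack \<one>\<^bsub>P\<^esub> \<zero>\<^bsub>P\<^esub> \<zero>\<^bsub>P\<^esub> \<zero>"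
  by (simp_all add: alg_def)

lemma alg_mult_closed [simp]:
  "\<lbrakk> h \<in> carrier P; k \<in> carrier P \<rbrakk> \<Longrightarrow> alg_mult h k \<in> carrier P"
  by (simp add: alg_mult_def)

lemma alg_mult_sel:
  "diag (alg_mult h k) = diag h \<otimes>\<^bsub>P\<^esub> diag k"
  "row (alg_mult h k) = cf (diag h) 0 \<odot>\<^bsub>P\<^esub> row k \<oplus>\<^bsub>P\<^esub> row h \<otimes>\<^bsub>P\<^esub> diag k"
  "col (alg_mult h k) = diag h \<otimes>\<^bsub>P\<^esub> col k \<oplus>\<^bsub>P\<^esub> cf (diag k) 0 \<odot>\<^bsub>P\<^esub> col h"
  "alg_mult h k 0 = cf (diag h) 0 \<otimes> k 0 \<oplus> lin w (row h \<otimes>\<^bsub>P\<^esub> col k) \<oplus> cf (diag k) 0 \<otimes> h 0"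
  by (simp_all add: alg_mult_def)

lemma alg_abelian_group: "abelian_group alg"
proof (rule abelian_groupI)
  fix h assume "h \<in> carrier alg"
  then show "\<exists>k\<in>carrier alg. k \<oplus>\<^bsub>alg\<^esub> h = \<zero>\<^bsub>alg\<^esub>"
    by (intro bexI[of _ "\<ominus>\<^bsub>P\<^esub> h"]) (simp_all add: P.l_neg)
qed (simp_all add: P.a_ac)

text \<open>Associativity has two sources. The value at 0 is multiplicative, so outer diagonal
  entries multiply correctly; and \<open>lin w\<close> sees only the product of its two factors, so
  \<open>diag k\<close> may be moved from \<open>row h\<close> to \<open>col l\<close> in the
  corner.\<close>

lemma alg_ring: "ring alg"
proof (rule ringI[OF alg_abelian_group])
  show "monoid alg"
  proof (rule monoidI)
    fix h k l assume "h \<in> carrier alg" "k \<in> carrier alg" "l \<in> carrier alg"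
    then have c: "h \<in> carrier P" "k \<in> carrier P" "l \<in> carrier P" by simp_all
    note d = sel_closed[OF c(1)] sel_closed[OF c(2)] sel_closed[OF c(3)]
    show "(h \<otimes>\<^bsub>alg\<^esub> k) \<otimes>\<^bsub>alg\<^esub> l = h \<otimes>\<^bsub>alg\<^esub> (k \<otimes>\<^bsub>alg\<^esub> l)"
      unfolding alg_sel
    proof (rule pack_eqI; unfold alg_mult_sel coeff_mult_0[OF d(1,5)] coeff_mult_0[OF d(5,9)])
      let ?a = "cf (diag h) 0" and ?b = "cf (diag k) 0" and ?c = "cf (diag l) 0"
      have abc: "?a \<in> carrier R" "?b \<in> carrier R" "?c \<in> carrier R" using d by simp_all
      show "diag h \<otimes>\<^bsub>P\<^esub> diag k \<otimes>\<^bsub>P\<^esub> diag l = diag h \<otimes>\<^bsub>P\<^esub> (diag k \<otimes>\<^bsub>P\<^esub> diag l)"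
        using d by (simp add: P.m_assoc)
      show "(?a \<otimes> ?b) \<odot>\<^bsub>P\<^esub> row l \<oplus>\<^bsub>P\<^esub> (?a \<odot>\<^bsub>P\<^esub> row k \<oplus>\<^bsub>P\<^esub> row h \<otimes>\<^bsub>P\<^esub> diag k) \<otimes>\<^bsub>P\<^esub> diag l
        = ?a \<odot>\<^bsub>P\<^esub> (?b \<odot>\<^bsub>P\<^esub> row l \<oplus>\<^bsub>P\<^esub> row k \<otimes>\<^bsub>P\<^esub> diag l) \<oplus>\<^bsub>P\<^esub> row h \<otimes>\<^bsub>P\<^esub> (diag k \<otimes>\<^bsub>P\<^esub> diag l)"
        using d abc by (simp add: UP_smult_r_distr UP_smult_assoc1 UP_smult_assoc2 P.l_distr P.m_assoc P.a_assoc)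
      show "diag h \<otimes>\<^bsub>P\<^esub> diag k \<otimes>\<^bsub>P\<^esub> col l \<oplus>\<^bsub>P\<^esub> ?c \<odot>\<^bsub>P\<^esub> (diag h \<otimes>\<^bsub>P\<^esub> col k \<oplus>\<^bsub>P\<^esub> ?b \<odot>\<^bsub>P\<^esub> col h)
        = diag h \<otimes>\<^bsub>P\<^esub> (diag k \<otimes>\<^bsub>P\<^esub> col l \<oplus>\<^bsub>P\<^esub> ?c \<odot>\<^bsub>P\<^esub> col k) \<oplus>\<^bsub>P\<^esub> (?b \<otimes> ?c) \<odot>\<^bsub>P\<^esub> col h"
        using d abc R.m_comm[OF abc(2,3)]
        by (simp add: UP_smult_r_distr UP_smult_assoc1 smult_mult_right P.r_distr P.m_assoc P.a_assoc)
      have "lin w ((?a \<odot>\<^bsub>P\<^esub> row k \<oplus>\<^bsub>P\<^esub> row h \<otimes>\<^bsub>P\<^esub> diag k) \<otimes>\<^bsub>P\<^esub> col l)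
          = ?a \<otimes> lin w (row k \<otimes>\<^bsub>P\<^esub> col l) \<oplus> lin w (row h \<otimes>\<^bsub>P\<^esub> (diag k \<otimes>\<^bsub>P\<^esub> col l))"
        using d abc by (simp add: P.l_distr lin_add lin_smult UP_smult_assoc2 P.m_assoc)
      moreover have "lin w (row h \<otimes>\<^bsub>P\<^esub> (diag k \<otimes>\<^bsub>P\<^esub> col l \<oplus>\<^bsub>P\<^esub> ?c \<odot>\<^bsub>P\<^esub> col k))
          = lin w (row h \<otimes>\<^bsub>P\<^esub> (diag k \<otimes>\<^bsub>P\<^esub> col l)) \<oplus> ?c \<otimes> lin w (row h \<otimes>\<^bsub>P\<^esub> col k)"
        using d abc by (simp add: P.r_distr lin_add lin_smult smult_mult_right)
      moreover have "lin w (row k \<otimes>\<^bsub>P\<^esub> col l) \<in> carrier R" "lin w (row h \<otimes>\<^bsub>P\<^esub> col k) \<in> carrier R"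
        "lin w (row h \<otimes>\<^bsub>P\<^esub> (diag k \<otimes>\<^bsub>P\<^esub> col l)) \<in> carrier R"
        using d by simp_all
      ultimately show "?a \<otimes> ?b \<otimes> l 0 \<oplus> lin w ((?a \<odot>\<^bsub>P\<^esub> row k \<oplus>\<^bsub>P\<^esub> row h \<otimes>\<^bsub>P\<^esub> diag k) \<otimes>\<^bsub>P\<^esub> col l)
          \<oplus> ?c \<otimes> (?a \<otimes> k 0 \<oplus> lin w (row h \<otimes>\<^bsub>P\<^esub> col k) \<oplus> ?b \<otimes> h 0)
        = ?a \<otimes> (?b \<otimes> l 0 \<oplus> lin w (row k \<otimes>\<^bsub>P\<^esub> col l) \<oplus> ?c \<otimes> k 0)
          \<oplus> lin w (row h \<otimes>\<^bsub>P\<^esub> (diag k \<otimes>\<^bsub>P\<^esub> col l \<oplus>\<^bsub>P\<^esub> ?c \<odot>\<^bsub>P\<^esub> col k)) \<oplus> (?b \<otimes> ?c) \<otimes> h 0"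
        using d(4,8,12) abc by (simp only:) algebra
    qed
  next
    fix h assume "h \<in> carrier alg"
    then have c: "h \<in> carrier P" by simp
    note s = c sel_closed[OF c]
    show "\<one>\<^bsub>alg\<^esub> \<otimes>\<^bsub>alg\<^esub> h = h"
      unfolding alg_sel by (rule pack_eqI) (simp_all add: alg_mult_sel s)
    show "h \<otimes>\<^bsub>alg\<^esub> \<one>\<^bsub>alg\<^esub> = h"
      unfolding alg_sel by (rule pack_eqI) (simp_all add: alg_mult_sel s)
  qed simp_all
next
  fix h k l assume "h \<in> carrier alg" "k \<in> carrier alg" "l \<in> carrier alg"
  then have c: "h \<in> carrier P" "k \<in> carrier P" "l \<in> carrier P" by simp_all
  note d = sel_closed[OF c(1)] sel_closed[OF c(2)] sel_closed[OF c(3)]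
  note s = c d lin_add lin_smult UP_smult_l_distr UP_smult_r_distr P.l_distr P.r_distr
    R.l_distr R.r_distr R.a_ac P.a_ac
  show "(h \<oplus>\<^bsub>alg\<^esub> k) \<otimes>\<^bsub>alg\<^esub> l = h \<otimes>\<^bsub>alg\<^esub> l \<oplus>\<^bsub>alg\<^esub> k \<otimes>\<^bsub>alg\<^esub> l"
    unfolding alg_sel
    by (rule pack_eqI) (simp_all add: alg_mult_sel s)
  show "l \<otimes>\<^bsub>alg\<^esub> (h \<oplus>\<^bsub>alg\<^esub> k) = l \<otimes>\<^bsub>alg\<^esub> h \<oplus>\<^bsub>alg\<^esub> l \<otimes>\<^bsub>alg\<^esub> k"
    unfolding alg_sel
    by (rule pack_eqI) (simp_all add: alg_mult_sel s)
qed

lemma alg_assoc_algebra: "assoc_algebra R alg"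
proof -
  have "module R alg"
    by (rule moduleI)
      (auto simp: alg_abelian_group UP_smult_l_distr UP_smult_r_distr UP_smult_assoc1 R.is_cring)
  moreover have "assoc_algebra_axioms R alg"
  proof
    fix a h k assume "a \<in> carrier R" "h \<in> carrier alg" "k \<in> carrier alg"
    then have c: "a \<in> carrier R" "h \<in> carrier P" "k \<in> carrier P" by simp_all
    note s = c sel_closed[OF c(2)] sel_closed[OF c(3)] lin_add lin_smult UP_smult_r_distr
      smult_mult_right UP_smult_assoc2 UP_smult_assoc1[symmetric] R.r_distr R.m_ac
    show "(a \<odot>\<^bsub>alg\<^esub> h) \<otimes>\<^bsub>alg\<^esub> k = a \<odot>\<^bsub>alg\<^esub> (h \<otimes>\<^bsub>alg\<^esub> k)"
      unfolding alg_sel by (rule pack_eqI) (simp_all add: alg_mult_sel s)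
    show "h \<otimes>\<^bsub>alg\<^esub> (a \<odot>\<^bsub>alg\<^esub> k) = a \<odot>\<^bsub>alg\<^esub> (h \<otimes>\<^bsub>alg\<^esub> k)"
      unfolding alg_sel by (rule pack_eqI) (simp_all add: alg_mult_sel s)
  qed
  ultimately show ?thesis using alg_ring by (simp add: assoc_algebra_def ring_def)
qed

section \<open>Shifting leading positions and the ascending chain condition\<close>

abbreviation "gen_x \<equiv> pack (mon \<one> 1) \<zero>\<^bsub>P\<^esub> \<zero>\<^bsub>P\<^esub> \<zero>"
abbreviation "gen_e \<equiv> pack \<zero>\<^bsub>P\<^esub> \<one>\<^bsub>P\<^esub> \<zero>\<^bsub>P\<^esub> \<zero>"
abbreviation "gen_f \<equiv> pack \<zero>\<^bsub>P\<^esub> \<zero>\<^bsub>P\<^esub> \<one>\<^bsub>P\<^esub> \<zero>"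

lemma X_mult_Suc: "p \<in> carrier P \<Longrightarrow> (mon \<one> 1 \<otimes>\<^bsub>P\<^esub> p) (Suc m) = p m"
  using coeff_X_mult[of p "Suc m"] by (simp add: cf_eq del: coeff_mult)

text \<open>The outer diagonal entries of \<open>gen_x\<close> vanish, so left multiplication erases
  the row and the corner, right multiplication the column and the corner.\<close>

lemma gen_x_mult:
  assumes h: "h \<in> carrier P"
  shows "alg_mult gen_x h = pack (mon \<one> 1 \<otimes>\<^bsub>P\<^esub> diag h) \<zero>\<^bsub>P\<^esub> (mon \<one> 1 \<otimes>\<^bsub>P\<^esub> col h) \<zero>"
    and "alg_mult h gen_x = pack (mon \<one> 1 \<otimes>\<^bsub>P\<^esub> diag h) (mon \<one> 1 \<otimes>\<^bsub>P\<^esub> row h) \<zero>\<^bsub>P\<^esub> \<zero>"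
  unfolding alg_mult_def using h sel_closed[OF h] by (simp_all add: P.m_comm)

text \<open>In the encoding, multiplication by the variable is a shift by 3. The left side loses
  only the residue 2 of \<open>row\<close>, the right side only the residue 0 of \<open>col\<close>,
  so every positive position survives on at least one side.\<close>

lemma gen_x_mult_apply:
  assumes h: "h \<in> carrier P" and n: "n > 0"
  shows "alg_mult gen_x h (n + 3) = (if n mod 3 = 2 then \<zero> else h n)"
    and "alg_mult h gen_x (n + 3) = (if n mod 3 = 0 then \<zero> else h n)"
proof -
  note c = sel_closed[OF h]
  show "alg_mult gen_x h (n + 3) = (if n mod 3 = 2 then \<zero> else h n)"
  proof (cases n rule: nat_pack_cases)
    case 1
    then show ?thesis using n by simp
  next
    case (2 m)
    then have e: "n + 3 = 3 * Suc m + 1" "n mod 3 = 1" by presburger+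
    show ?thesis
      unfolding e gen_x_mult(1)[OF h] pack_apply
      using X_mult_Suc[OF c(1), of m] 2 by (simp add: diag_def zero_eq)
  next
    case (3 m)
    then have e: "n + 3 = 3 * Suc m + 2" "n mod 3 = 2" by presburger+
    show ?thesis
      unfolding e gen_x_mult(1)[OF h] pack_apply
      using X_mult_Suc[OF c(2), of m] 3 by (simp add: row_def zero_eq)
  next
    case (4 m)
    then have e: "n + 3 = 3 * Suc m + 3" "n mod 3 = 0" by presburger+
    show ?thesis
      unfolding e gen_x_mult(1)[OF h] pack_apply
      using X_mult_Suc[OF c(3), of m] 4 by (simp add: col_def zero_eq)
  qed
  show "alg_mult h gen_x (n + 3) = (if n mod 3 = 0 then \<zero> else h n)"
  proof (cases n rule: nat_pack_cases)
    case 1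
    then show ?thesis using n by simp
  next
    case (2 m)
    then have e: "n + 3 = 3 * Suc m + 1" "n mod 3 = 1" by presburger+
    show ?thesis
      unfolding e gen_x_mult(2)[OF h] pack_apply
      using X_mult_Suc[OF c(1), of m] 2 by (simp add: diag_def zero_eq)
  next
    case (3 m)
    then have e: "n + 3 = 3 * Suc m + 2" "n mod 3 = 2" by presburger+
    show ?thesis
      unfolding e gen_x_mult(2)[OF h] pack_apply
      using X_mult_Suc[OF c(2), of m] 3 by (simp add: row_def zero_eq)
  next
    case (4 m)
    then have e: "n + 3 = 3 * Suc m + 3" "n mod 3 = 0" by presburger+
    show ?thesis
      unfolding e gen_x_mult(2)[OF h] pack_apply
      using X_mult_Suc[OF c(3), of m] 4 by (simp add: col_def zero_eq)
  qed
qed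

lemma leads_add_3:
  assumes V: "V \<subseteq> carrier P"
    and x: "\<And>h. h \<in> V \<Longrightarrow> alg_mult gen_x h \<in> V \<and> alg_mult h gen_x \<in> V"
    and n: "n \<in> leads V" "n > 0"
  shows "n + 3 \<in> leads V"
proof -
  obtain h where h: "h \<in> V" "h n \<noteq> \<zero>" "\<forall>i>n. h i = \<zero>" using n by (auto simp: leads_def)
  \<comment> \<open>The side is chosen so that the leading coefficient is not erased.\<close>
  define k where "k = (if n mod 3 = 2 then alg_mult h gen_x else alg_mult gen_x h)"
  have hP: "h \<in> carrier P" using h V by blast
  have "k i = \<zero>" if i: "i > n + 3" for i
  proof -
    have "i = (i - 3) + 3" "i - 3 > n" using i by simp_all
    then show ?thesis
      using gen_x_mult_apply[OF hP, of "i - 3"] h(3) by (auto simp: k_def)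
  qed
  moreover have "k (n + 3) = h n"
    unfolding k_def using gen_x_mult_apply[OF hP n(2)] by simp
  moreover have "k \<in> V" using x h by (simp add: k_def)
  ultimately show ?thesis using h(2) unfolding leads_def mem_Collect_eq by metis
qed

lemma alg_acc_ideals:
  assumes F: "field R"
  shows "acc_ideals alg"
  unfolding acc_ideals_def
proof (intro allI impI)
  fix I :: "nat \<Rightarrow> (nat \<Rightarrow> 'a) set"
  assume "\<forall>k. ideal (I k) alg \<and> I k \<subseteq> I (Suc k)"
  then have I: "ideal (I k) alg" and mono: "I k \<subseteq> I (Suc k)" for k by blast+
  have le: "I i \<subseteq> I j" if "i \<le> j" for i j
    using that mono by (rule lift_Suc_mono_le[of I, rotated])
  have car: "I k \<subseteq> carrier P" for k
    using ideal.axioms(1)[OF I[of k]] additive_subgroup.a_subset by fastforce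
  have add: "h \<oplus>\<^bsub>P\<^esub> h' \<in> I k" if "h \<in> I k" "h' \<in> I k" for h h' k
    using additive_subgroup.a_closed[OF ideal.axioms(1)[OF I[of k]] that] by simp
  have zero: "\<zero>\<^bsub>P\<^esub> \<in> I k" for k
    using additive_subgroup.zero_closed[OF ideal.axioms(1)[OF I[of k]]] by simp
  have mult: "alg_mult a h \<in> I k" "alg_mult h a \<in> I k" if "h \<in> I k" "a \<in> carrier P" for h a k
    using ideal.I_l_closed[OF I[of k], of h a] ideal.I_r_closed[OF I[of k], of h a] that by simp_all
  \<comment> \<open>Ring ideals are closed under scalars, because \<open>a\<close> acts as
    multiplication by \<open>a\<close> times the unit.\<close>
  have smult: "a \<odot>\<^bsub>P\<^esub> h \<in> I k" if "a \<in> carrier R" "h \<in> I k" for a h k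
  proof -
    interpret A: assoc_algebra R alg by (rule alg_assoc_algebra)
    have h: "h \<in> carrier P" using that car by blast
    have "(a \<odot>\<^bsub>alg\<^esub> \<one>\<^bsub>alg\<^esub>) \<otimes>\<^bsub>alg\<^esub> h = a \<odot>\<^bsub>alg\<^esub> (\<one>\<^bsub>alg\<^esub> \<otimes>\<^bsub>alg\<^esub> h)"
      using that h by (intro A.smult_mult_left) auto
    also have "\<one>\<^bsub>alg\<^esub> \<otimes>\<^bsub>alg\<^esub> h = h" using h A.l_one[of h] by (simp only: alg_sel(1))
    finally have "a \<odot>\<^bsub>P\<^esub> h = alg_mult (a \<odot>\<^bsub>P\<^esub> pack \<one>\<^bsub>P\<^esub> \<zero>\<^bsub>P\<^esub> \<zero>\<^bsub>P\<^esub> \<zero>) h" by simp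
    then show ?thesis using mult(1)[OF that(2)] that by simp
  qed
  have "\<exists>N. \<forall>k. leads (I k) \<subseteq> leads (I N)"
  proof (rule chain_of_shift_closed_sets_stabilizes[where d = 3])
    fix k n assume "n \<in> leads (I k)" "n > 0"
    then show "n + 3 \<in> leads (I k)" using mult by (intro leads_add_3[OF car]) auto
  qed (simp_all add: leads_mono mono)
  then obtain N where N: "\<And>k. leads (I k) \<subseteq> leads (I N)" by blast
  have "I k = I N" if "k \<ge> N" for k
    using subset_of_leads_subset[OF F car car le[OF that] zero add smult add smult N] le[OF that] by blast
  then show "\<exists>N. \<forall>k\<ge>N. I k = I N" by blast
qed

section \<open>Finite generation\<close>

lemma alg_affine:
  assumes F: "field R" and w0: "w 0 \<noteq> \<zero>"
  shows "affine_algebra R alg"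
  unfolding affine_algebra_def
proof (intro exI conjI allI impI)
  show "finite {gen_x, gen_e, gen_f}" "{gen_x, gen_e, gen_f} \<subseteq> carrier alg" by auto
  fix B assume "unital_subalgebra R alg B \<and> {gen_x, gen_e, gen_f} \<subseteq> B"
  then have B: "subring B alg" and smult: "\<And>a h. \<lbrakk> a \<in> carrier R; h \<in> B \<rbrakk> \<Longrightarrow> a \<odot>\<^bsub>P\<^esub> h \<in> B"
    and gens: "gen_x \<in> B" "gen_e \<in> B" "gen_f \<in> B"
    by (auto simp: unital_subalgebra_def)
  have car: "B \<subseteq> carrier P" using subringE(1)[OF B] by simp
  have add: "h \<oplus>\<^bsub>P\<^esub> k \<in> B" and mult: "alg_mult h k \<in> B" if "h \<in> B" "k \<in> B" for h k
    using subringE(7,6)[OF B that] by simp_all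
  have one: "pack \<one>\<^bsub>P\<^esub> \<zero>\<^bsub>P\<^esub> \<zero>\<^bsub>P\<^esub> \<zero> \<in> B" using subringE(3)[OF B] by simp
  have zero: "\<zero>\<^bsub>P\<^esub> \<in> B" using subringE(2)[OF B] by simp
  \<comment> \<open>No element is written in the generators explicitly: it suffices that every
    position is a leading position of \<open>B\<close>.\<close>
  have lead: "n \<in> leads B" for n
  proof (induction n rule: less_induct)
    case (less n)
    interpret F: field R by fact
    have one_apply: "\<one>\<^bsub>P\<^esub> i = (if i = 0 then \<one> else \<zero>)" for i
      unfolding P_def UP_def by simp
    \<comment> \<open>This product is \<open>w 0\<close> times the corner unit and reaches position
      0.\<close>
    have "alg_mult gen_e gen_f = pack \<zero>\<^bsub>P\<^esub> \<zero>\<^bsub>P\<^esub> \<zero>\<^bsub>P\<^esub> (w 0)"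
      using lin_monom[of \<one> w 0] by (simp add: alg_mult_def)
    then have corner: "pack \<zero>\<^bsub>P\<^esub> \<zero>\<^bsub>P\<^esub> \<zero>\<^bsub>P\<^esub> (w 0) \<in> B" using mult[OF gens(2,3)] by simp
    \<comment> \<open>The shift by 3 starts from positive positions only, so 3 is a base case and
      not a shift of 0. Positions 1, 2, 3 are led by the unit, \<open>gen_e\<close> and
      \<open>gen_f\<close>.\<close>
    consider "n = 0" | "n = 1" | "n = 2" | "n = 3" | "n > 3" by linarith
    then show ?case
    proof cases
      case 1
      then show ?thesis unfolding leads_def using w0
        by (auto intro!: bexI[OF _ corner] simp: pack_def zero_eq split: nat.split)
    next
      case 2
      then show ?thesis unfolding leads_def
        by (auto intro!: bexI[OF _ one] simp: pack_def zero_eq one_apply split: nat.split)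
    next
      case 3
      then show ?thesis unfolding leads_def
        by (auto intro!: bexI[OF _ gens(2)] simp: pack_def zero_eq one_apply split: nat.split)
    next
      case 4
      then show ?thesis unfolding leads_def
        by (auto intro!: bexI[OF _ gens(3)] simp: pack_def zero_eq one_apply split: nat.split)
    next
      case 5
      then have "n - 3 \<in> leads B" by (intro less) auto
      then have "n - 3 + 3 \<in> leads B" using 5 mult gens by (intro leads_add_3[OF car]) auto
      then show ?thesis using 5 by simp
    qed
  qed
  have "carrier P \<subseteq> B"
    by (rule subset_of_leads_subset[OF F car order_refl car zero add smult]) (use lead in auto)
  then show "B = carrier alg" using car by auto
qed

section \<open>The polynomial identity\<close>

lemma alg_PI:
  assumes "\<one> \<noteq> \<zero>"
  shows "PI_algebra R alg"
proof -
  interpret A: assoc_algebra R alg by (rule alg_assoc_algebra)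
  show ?thesis
  proof (rule A.PI_algebra_commutator_cube[OF assms])
    fix h k assume "h \<in> carrier alg" "k \<in> carrier alg"
    then have c: "h \<in> carrier P" "k \<in> carrier P" by simp_all
    define u where "u = h \<otimes>\<^bsub>alg\<^esub> k \<ominus>\<^bsub>alg\<^esub> k \<otimes>\<^bsub>alg\<^esub> h"
    have u: "u \<in> carrier P"
    proof -
      have "u \<in> carrier alg" unfolding u_def using c by (intro A.minus_closed) auto
      then show ?thesis by simp
    qed
    \<comment> \<open>The difference is rewritten as a sum, to which the rules for the selectors
      apply.\<close>
    have "u \<oplus>\<^bsub>alg\<^esub> k \<otimes>\<^bsub>alg\<^esub> h = h \<otimes>\<^bsub>alg\<^esub> k"
    proof -
      have "h \<otimes>\<^bsub>alg\<^esub> k \<in> carrier alg" "k \<otimes>\<^bsub>alg\<^esub> h \<in> carrier alg" using c by simp_all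
      then show ?thesis unfolding u_def by algebra
    qed
    then have "diag (u \<oplus>\<^bsub>P\<^esub> alg_mult k h) = diag (alg_mult h k)" by simp
    then have "diag u \<oplus>\<^bsub>P\<^esub> diag h \<otimes>\<^bsub>P\<^esub> diag k = diag h \<otimes>\<^bsub>P\<^esub> diag k"
      using c u sel_closed(1)[OF c(1)] sel_closed(1)[OF c(2)] by (simp add: alg_mult_sel P.m_comm)
    then have d: "diag u = \<zero>\<^bsub>P\<^esub>"
      using sel_closed(1)[OF u] sel_closed(1)[OF c(1)] sel_closed(1)[OF c(2)]
      by (metis P.add.l_cancel_one' P.a_comm P.m_closed)
    \<comment> \<open>As for strictly upper triangular matrices of size 3: the square of
      \<open>u\<close> has only a corner entry, which \<open>u\<close> then annihilates.\<close>
    have "alg_mult (alg_mult u u) u = \<zero>\<^bsub>P\<^esub>"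
      by (rule pack_eqI) (use d u sel_closed[OF u] in \<open>simp_all add: alg_mult_sel\<close>)
    then show "(h \<otimes>\<^bsub>alg\<^esub> k \<ominus>\<^bsub>alg\<^esub> k \<otimes>\<^bsub>alg\<^esub> h) \<otimes>\<^bsub>alg\<^esub> (h \<otimes>\<^bsub>alg\<^esub> k \<ominus>\<^bsub>alg\<^esub> k \<otimes>\<^bsub>alg\<^esub> h)
        \<otimes>\<^bsub>alg\<^esub> (h \<otimes>\<^bsub>alg\<^esub> k \<ominus>\<^bsub>alg\<^esub> k \<otimes>\<^bsub>alg\<^esub> h) = \<zero>\<^bsub>alg\<^esub>"
      unfolding u_def[symmetric] by simp
  qed
qed

section \<open>Failure of weak representability\<close>

lemma alg_not_weakly_representable:
  assumes one: "\<one> \<noteq> \<zero>" and w01: "\<And>i. w i = \<zero> \<or> w i = \<one>"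
    and gaps: "\<And>N. \<exists>k. w (k + N) = \<one> \<and> (\<forall>i<N. w (k + i) = \<zero>)"
  shows "\<not> weakly_representable alg"
proof
  assume "weakly_representable alg"
  then obtain n and C :: "((nat \<times> (nat \<Rightarrow> 'a)) list) ring" and \<phi>
    where C: "cring C" and hom: "\<phi> \<in> ring_hom alg (matrix_ring n C)" and inj: "inj_on \<phi> (carrier alg)"
    unfolding weakly_representable_def embeds_in_matrix_ring_def by blast
  interpret C: UP_cring C "UP C" by (intro UP_cring.intro C)
  let ?Z = "\<zero>\<^bsub>P\<^esub>"
  define g where "g = pack ?Z ?Z ?Z \<one>"
  \<comment> \<open>The k-th power of \<open>gen_x\<close> times \<open>gen_f\<close>.\<close>
  define F where "F k = pack ?Z ?Z (mon \<one> k) \<zero>" for k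
  have gens: "gen_x \<in> carrier alg" "gen_e \<in> carrier alg" "F k \<in> carrier alg" "g \<in> carrier alg" for k
    by (simp_all add: g_def F_def)
  have Fsuc: "F (Suc k) = gen_x \<otimes>\<^bsub>alg\<^esub> F k" for k
    using gen_x_mult(1)[of "F k"] using monom_one_Suc2[of k] by (simp add: F_def)
  have zero: "\<zero>\<^bsub>alg\<^esub> = pack ?Z ?Z ?Z \<zero>" by (rule pack_eqI) simp_all
  \<comment> \<open>The map \<open>\<phi>\<close> is a ring homomorphism and knows nothing of the
    scalars. Weights 0 and 1 make these products equal to \<open>g\<close> or zero, with no scalar
    left.\<close>
  have eF: "gen_e \<otimes>\<^bsub>alg\<^esub> F k = (if w k = \<one> then g else \<zero>\<^bsub>alg\<^esub>)" for k
    using w01[of k] lin_monom[of \<one> w k] unfolding zero by (auto simp: F_def g_def alg_mult_def)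
  have el: "\<phi> a (i, j) \<in> carrier C" if "a \<in> carrier alg" "i < n" "j < n" for a i j
    using ring_hom_memE(1)[OF hom that(1)] that(2,3) by (auto simp: matrix_ring_def)
  have mult: "\<phi> (a \<otimes>\<^bsub>alg\<^esub> b) (i, j) = (\<Oplus>\<^bsub>C\<^esub>k\<in>{..<n}. \<phi> a (i, k) \<otimes>\<^bsub>C\<^esub> \<phi> b (k, j))"
    if "a \<in> carrier alg" "b \<in> carrier alg" "i < n" "j < n" for a b i j
    using ring_hom_memE(2)[OF hom that(1,2)] that(3,4) by (simp add: matrix_ring_def)
  interpret A: ring alg by (rule alg_ring)
  \<comment> \<open>Preservation of zero is not part of \<open>ring_hom\<close>; it follows from
    additivity by cancelling in each entry.\<close>
  have \<phi>0: "\<phi> \<zero>\<^bsub>alg\<^esub> (i, j) = \<zero>\<^bsub>C\<^esub>" if "i < n" "j < n" for i j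
  proof -
    have "\<phi> \<zero>\<^bsub>alg\<^esub> = \<phi> (\<zero>\<^bsub>alg\<^esub> \<oplus>\<^bsub>alg\<^esub> \<zero>\<^bsub>alg\<^esub>)" by (simp only: A.l_zero A.zero_closed)
    also have "\<dots> = \<phi> \<zero>\<^bsub>alg\<^esub> \<oplus>\<^bsub>matrix_ring n C\<^esub> \<phi> \<zero>\<^bsub>alg\<^esub>"
      by (rule ring_hom_memE(3)[OF hom]) (rule A.zero_closed)+
    finally have "\<phi> \<zero>\<^bsub>alg\<^esub> (i, j) = (\<phi> \<zero>\<^bsub>alg\<^esub> \<oplus>\<^bsub>matrix_ring n C\<^esub> \<phi> \<zero>\<^bsub>alg\<^esub>) (i, j)"
      by (rule fun_cong)
    also have "\<dots> = \<phi> \<zero>\<^bsub>alg\<^esub> (i, j) \<oplus>\<^bsub>C\<^esub> \<phi> \<zero>\<^bsub>alg\<^esub> (i, j)"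
      using that by (simp add: matrix_ring_def)
    finally show ?thesis
      using C.R.add.l_cancel_one'[of "\<phi> \<zero>\<^bsub>alg\<^esub> (i, j)" "\<phi> \<zero>\<^bsub>alg\<^esub> (i, j)"] el[OF A.zero_closed that] by simp
  qed
  have G: "\<phi> g (p, q) = \<zero>\<^bsub>C\<^esub>" if pq: "p < n" "q < n" for p q
  proof -
    \<comment> \<open>Column \<open>q\<close> of the images of the \<open>F k\<close> is an orbit of
      vectors under the matrix of \<open>gen_x\<close>.\<close>
    define v where "v j k = \<phi> (F k) (j, q)" for j k
    \<comment> \<open>The entry \<open>(p, q)\<close> of the image of \<open>gen_e\<close> times
      \<open>F k\<close>: a combination of the \<open>v j\<close>, so it inherits their
      recurrence.\<close>
    define u where "u k = (\<Oplus>\<^bsub>C\<^esub>j\<in>{..<n}. \<phi> gen_e (p, j) \<otimes>\<^bsub>C\<^esub> v j k)" for k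
    have vc: "v j k \<in> carrier C" if "j < n" for j k
      unfolding v_def using el[OF gens(3)] that pq by simp
    have u: "u k = (if w k = \<one> then \<phi> g (p, q) else \<zero>\<^bsub>C\<^esub>)" for k
      unfolding u_def v_def mult[OF gens(2,3) pq, symmetric] eF using \<phi>0[OF pq] by simp
    have uc: "u k \<in> carrier C" for k
      unfolding u using el[OF gens(4) pq] by simp
    have "\<exists>N c. C.monic N c \<and> (\<forall>j<n. \<forall>k. C.lin (\<lambda>l. v j (k + l)) c = \<zero>\<^bsub>C\<^esub>)"
    proof (rule C.matrix_orbit_recurrence[where x = "\<lambda>i j. \<phi> gen_x (i, j)"])
      fix i k assume "i < n"
      then show "v i (Suc k) = (\<Oplus>\<^bsub>C\<^esub>j\<in>{..<n}. \<phi> gen_x (i, j) \<otimes>\<^bsub>C\<^esub> v j k)"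
        unfolding v_def Fsuc using mult[OF gens(1,3) _ pq(2)] by simp
    qed (use vc el[OF gens(1)] in auto)
    then obtain N c where c: "C.monic N c"
      and rec: "\<And>j k. j < n \<Longrightarrow> C.lin (\<lambda>l. v j (k + l)) c = \<zero>\<^bsub>C\<^esub>" by blast
    have cc: "c \<in> carrier (UP C)" and cN: "C.cf c N = \<one>\<^bsub>C\<^esub>" "\<And>i. i > N \<Longrightarrow> C.cf c i = \<zero>\<^bsub>C\<^esub>"
      using c by (auto simp: C.monic_def)
    \<comment> \<open>The order \<open>N\<close> is known first, then the gap is chosen: in the
      window from \<open>k\<close> to \<open>k + N\<close> only the last weight is nonzero, and
      there the recurrence has coefficient 1. Hence it reduces to the entry of
      \<open>\<phi> g\<close>.\<close>
    obtain k where k: "w (k + N) = \<one>" "\<forall>i<N. w (k + i) = \<zero>" using gaps by blast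
    have "C.lin (\<lambda>l. u (k + l)) c = (\<Oplus>\<^bsub>C\<^esub>j\<in>{..<n}. \<phi> gen_e (p, j) \<otimes>\<^bsub>C\<^esub> C.lin (\<lambda>l. v j (k + l)) c)"
      unfolding u_def by (rule C.lin_sum_weights) (use cc vc el[OF gens(2)] pq in auto)
    also have "\<dots> = \<zero>\<^bsub>C\<^esub>"
      by (rule C.R.add.finprod_one_eqI) (use rec el[OF gens(2)] pq in auto)
    finally have "\<zero>\<^bsub>C\<^esub> = C.lin (\<lambda>l. u (k + l)) c" ..
    also have "\<dots> = (\<Oplus>\<^bsub>C\<^esub>l\<in>{..N}. C.cf c l \<otimes>\<^bsub>C\<^esub> u (k + l))"
      by (rule C.lin_eq) (use cc cN uc in auto)
    also have "\<dots> = (\<Oplus>\<^bsub>C\<^esub>l\<in>{..N}. if N = l then \<phi> g (p, q) else \<zero>\<^bsub>C\<^esub>)"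
      by (rule C.R.finsum_cong') (use cc cN k one el[OF gens(4) pq] in \<open>auto simp: u\<close>)
    also have "\<dots> = \<phi> g (p, q)"
      by (rule C.R.finsum_singleton) (use el[OF gens(4) pq] in auto)
    finally show ?thesis ..
  qed
  have "\<phi> g = \<phi> \<zero>\<^bsub>alg\<^esub>"
  proof (rule PiE_ext)
    show "\<phi> g \<in> {..<n} \<times> {..<n} \<rightarrow>\<^sub>E carrier C" "\<phi> \<zero>\<^bsub>alg\<^esub> \<in> {..<n} \<times> {..<n} \<rightarrow>\<^sub>E carrier C"
      using ring_hom_memE(1)[OF hom gens(4)] ring_hom_memE(1)[OF hom A.zero_closed]
      by (simp_all add: matrix_ring_def)
  qed (auto simp: G \<phi>0 simp del: alg_sel)
  then have "g = \<zero>\<^bsub>alg\<^esub>" using inj gens(4) A.zero_closed by (auto dest: inj_onD)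
  then have "g 0 = \<zero>" by simp
  then show False using one by (simp add: g_def)
qed

end


section \<open>The weight supported on the squares\<close>

theorem mainTheorem4:
  fixes F :: "('a, 'm) ring_scheme"
  assumes "field F"
  shows "\<exists>A :: ('a, nat \<Rightarrow> 'a) module.
           assoc_algebra F A \<and> affine_algebra F A \<and> PI_algebra F A \<and> acc_ideals A \<and>
           \<not> weakly_representable A"
proof -
  interpret F: field F by fact
  define w :: "nat \<Rightarrow> 'a" where "w i = (if \<exists>t. i = t\<^sup>2 then \<one>\<^bsub>F\<^esub> else \<zero>\<^bsub>F\<^esub>)" for i
  interpret A: pairing_algebra F "UP F" w
    by unfold_locales (simp add: w_def)
  have gaps: "\<exists>k. w (k + N) = \<one>\<^bsub>F\<^esub> \<and> (\<forall>i<N. w (k + i) = \<zero>\<^bsub>F\<^esub>)" for N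
  proof (intro exI conjI allI impI)
    \<comment> \<open>The window must end exactly at the next square after the square of
      \<open>N\<close>. It thus starts \<open>N\<close> places before that square, and its first
      \<open>N\<close> positions lie strictly between the two squares.\<close>
    have N: "N\<^sup>2 + N + 1 + N = (N + 1)\<^sup>2" by (simp add: power2_eq_square)
    then show "w (N\<^sup>2 + N + 1 + N) = \<one>\<^bsub>F\<^esub>" unfolding w_def by auto
    fix i assume "i < N"
    then have "N\<^sup>2 < N\<^sup>2 + N + 1 + i" "N\<^sup>2 + N + 1 + i < (N + 1)\<^sup>2" using N by linarith+
    then have "N\<^sup>2 + N + 1 + i \<noteq> t\<^sup>2" for t
      by (metis Suc_eq_plus1 less_Suc_eq_le not_le power2_less_imp_less power_mono zero_le)
    then show "w (N\<^sup>2 + N + 1 + i) = \<zero>\<^bsub>F\<^esub>" unfolding w_def by simp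
  qed
  have "w 0 \<noteq> \<zero>\<^bsub>F\<^esub>" by (simp add: w_def)
  then have "affine_algebra F A.alg" by (rule A.alg_affine[OF assms])
  moreover have "\<not> weakly_representable A.alg"
    by (rule A.alg_not_weakly_representable[OF _ _ gaps]) (auto simp: w_def)
  ultimately show ?thesis
    using A.alg_assoc_algebra A.alg_PI[OF F.one_not_zero] A.alg_acc_ideals[OF assms] by blast
qed

end
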